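(* Let $(G,w,a)$ be an infinite, connected, oriented, weighted graph $G=(V,E)$ without loops or multiple edges, with bounded vertex degree: there is a constant $N>0$ such that every vertex $x\in V$ has degree $m(x)\le N$. Let $\sigma\colon E_0\to U(1)$ satisfy $\sigma(\widehat e)=\overline{\sigma(e)}$ for all $e\in E_0$. Let $q\colon V\to[1,\infty)$ and $W\colon V\to\mathbb{R}$ satisfy $W(x)\ge -q(x)$ for all $x\in V$, and assume there is a constant $C$ such that $$|q^{-1/2}(t(e))-q^{-1/2}(o(e))|\le C\left(\frac{\min\{w(t(e)),w(o(e))\}}{a(e)}\right)^{1/2}\qquad\text{for all } e\in E_s.$$ Assume additionally that $(G,d_{w,a;q})$ is a complete metric space. Then the operator $H|_{C_c(V)}$, where $Hu=\Delta_\sigma u+Wu$, is essentially self-adjoint in $\ell^2_w(V)$.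
   Context: Graph notation: $G=(V,E)$ is a graph with vertex set $V$ and set of unoriented edges $E$; $x\sim y$ means that an edge connects $x$ and $y$; $m(x)$ is the number of edges that meet at $x$. $E_0=\{[x,y],[y,x]: x,y\in V,\ x\sim y\}$ is the set of oriented edges. For $e=[x,y]\in E_0$ put $o(e)=x$, $t(e)=y$, $\widehat e=[y,x]$. An orientation is fixed: $E_s\subset E_0$ is a subset such that $E_0$ is the disjoint union of $E_s$ and $\widehat{E_s}=\{\widehat e: e\in E_s\}$. The graph is connected: any two vertices are joined by a finite path $x_1,\dots,x_n$ with $x_j\sim x_{j+1}$ for $1\le j\le n-1$. Weights: $w\colon V\to\mathbb{R}^+$ and $a\colon E_0\to\mathbb{R}^+$ are strictly positive, with $a(e)=a(\widehat e)$ for all $e\in E_0$. Spaces: $C(V)$ is the set of complex-valued functions on $V$, $C_c(V)$ the set of finitely supported ones, and $\ell^2_w(V)$ is the Hilbert space of $f\in C(V)$ with $\|f\|<\infty$, where $\|\cdot\|$ is the norm of the inner product $(f,g)=\sum_{x\in V}w(x)f(x)\overline{g(x)}$. Operators: $U(1)=\{z\in\mathbb{C}:|z|=1\}$. The magnetic Laplacian $\Delta_\sigma\colon C(V)\to C(V)$ is $$(\Delta_\sigma u)(x)=\frac1{w(x)}\sum_{e\in E_0,\ o(e)=x}a(e)\bigl(u(x)-\sigma(\widehat e)u(t(e))\bigr).$$ Metric: $$d_{w,a;q}(x,y)=\inf_{\gamma}\sum_{j=1}^{n-1}\frac{\min\{w^{1/2}(x_j),w^{1/2}(x_{j+1})\}\cdot\min\{q^{-1/2}(x_j),q^{-1/2}(x_{j+1})\}}{\sqrt{a([x_j,x_{j+1}])}},$$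 where the infimum is over all finite paths $\gamma\colon x=x_1,\dots,x_n=y$ with $x_j\sim x_{j+1}$. Completeness of $(G,d_{w,a;q})$ means that every Cauchy sequence of vertices has a limit in $V$. *)

theory Defs
  imports "HOL-Analysis.Analysis"
begin

section \<open>Graphs\<close>

text \<open>
  A graph is a vertex set \<open>V\<close> with a set \<open>E\<close> of two-element subsets of \<open>V\<close>, so that loops and
  multiple edges are excluded. The oriented edge from \<open>x\<close> to \<open>y\<close> is the pair \<open>(x, y)\<close>: its
  origin is \<open>fst\<close>, its terminus is \<open>snd\<close>, and reversal is \<open>prod.swap\<close>.
\<close>

definition simple_graph :: "'v set \<Rightarrow> 'v set set \<Rightarrow> bool" where
  "simple_graph V E \<longleftrightarrow> (\<forall>e\<in>E. \<exists>x\<in>V. \<exists>y\<in>V. x \<noteq> y \<and> e = {x, y})"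

definition oriented_edges :: "'v set set \<Rightarrow> ('v \<times> 'v) set" where
  "oriented_edges E = {(x, y). {x, y} \<in> E}"

definition orientation :: "'v set set \<Rightarrow> ('v \<times> 'v) set \<Rightarrow> bool" where
  "orientation E Es \<longleftrightarrow>
     Es \<subseteq> oriented_edges E \<and>
     oriented_edges E = Es \<union> prod.swap ` Es \<and> Es \<inter> prod.swap ` Es = {}"

text \<open>Finiteness is explicit because \<open>card\<close> of an infinite set is \<open>0\<close>.\<close>

definition bounded_degree :: "'v set \<Rightarrow> 'v set set \<Rightarrow> bool" where
  "bounded_degree V E \<longleftrightarrow>
     (\<exists>N::nat. N > 0 \<and> (\<forall>x\<in>V. finite {e \<in> E. x \<in> e} \<and> card {e \<in> E. x \<in> e} \<le> N))"

text \<open>A path is its list of vertices; the one-vertex path joins a vertex to itself.\<close>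

definition graph_path :: "'v set \<Rightarrow> 'v set set \<Rightarrow> 'v \<Rightarrow> 'v list \<Rightarrow> 'v \<Rightarrow> bool" where
  "graph_path V E x p y \<longleftrightarrow>
     p \<noteq> [] \<and> hd p = x \<and> last p = y \<and> set p \<subseteq> V \<and>
     (\<forall>j. Suc j < length p \<longrightarrow> {p ! j, p ! Suc j} \<in> E)"

definition connected_graph :: "'v set \<Rightarrow> 'v set set \<Rightarrow> bool" where
  "connected_graph V E \<longleftrightarrow> (\<forall>x\<in>V. \<forall>y\<in>V. \<exists>p. graph_path V E x p y)"

definition path_weight ::
  "('v \<Rightarrow> real) \<Rightarrow> ('v \<times> 'v \<Rightarrow> real) \<Rightarrow> ('v \<Rightarrow> real) \<Rightarrow> 'v list \<Rightarrow> real" where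
  "path_weight w a q p =
     (\<Sum>j<length p - 1.
        min (sqrt (w (p ! j))) (sqrt (w (p ! Suc j))) *
        min (1 / sqrt (q (p ! j))) (1 / sqrt (q (p ! Suc j))) /
        sqrt (a (p ! j, p ! Suc j)))"

text \<open>
  The value off \<open>V\<close> is set to \<open>0\<close> because the library locale \<open>Metric_space\<close> asks for
  nonnegativity and symmetry of the distance on the whole type.
\<close>

definition path_dist ::
  "'v set \<Rightarrow> 'v set set \<Rightarrow> ('v \<Rightarrow> real) \<Rightarrow> ('v \<times> 'v \<Rightarrow> real) \<Rightarrow> ('v \<Rightarrow> real) \<Rightarrow> 'v \<Rightarrow> 'v \<Rightarrow> real" where
  "path_dist V E w a q x y =
     (if x \<in> V \<and> y \<in> V then Inf (path_weight w a q ` {p. graph_path V E x p y}) else 0)"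


section \<open>Function spaces on the vertex set\<close>

text \<open>A function on \<open>V\<close> is represented by its extension by \<open>0\<close> to the whole type.\<close>

definition vertex_functions :: "'v set \<Rightarrow> ('v \<Rightarrow> complex) set" where
  "vertex_functions V = {u. \<forall>x. x \<notin> V \<longrightarrow> u x = 0}"

definition finitely_supported :: "'v set \<Rightarrow> ('v \<Rightarrow> complex) set" where
  "finitely_supported V = {u \<in> vertex_functions V. finite {x \<in> V. u x \<noteq> 0}}"

definition l2 :: "('v \<Rightarrow> real) \<Rightarrow> 'v set \<Rightarrow> ('v \<Rightarrow> complex) set" where
  "l2 w V = {f \<in> vertex_functions V. (\<lambda>x. w x * (cmod (f x))\<^sup>2) summable_on V}"

definition l2_inner ::
  "('v \<Rightarrow> real) \<Rightarrow> 'v set \<Rightarrow> ('v \<Rightarrow> complex) \<Rightarrow> ('v \<Rightarrow> complex) \<Rightarrow> complex" where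
  "l2_inner w V f g = (\<Sum>\<^sub>\<infinity>x\<in>V. complex_of_real (w x) * f x * cnj (g x))"

definition l2_norm :: "('v \<Rightarrow> real) \<Rightarrow> 'v set \<Rightarrow> ('v \<Rightarrow> complex) \<Rightarrow> real" where
  "l2_norm w V f = sqrt (Re (l2_inner w V f f))"


section \<open>Unbounded operators\<close>

text \<open>
  An unbounded operator in \<open>l2 w V\<close> is identified with its graph, a set of pairs
  \<open>(argument, value)\<close>; its domain is the \<open>Domain\<close> of this relation.
\<close>

type_synonym 'v operator_graph = "(('v \<Rightarrow> complex) \<times> ('v \<Rightarrow> complex)) set"

definition restricted_operator ::
  "(('v \<Rightarrow> complex) \<Rightarrow> ('v \<Rightarrow> complex)) \<Rightarrow> ('v \<Rightarrow> complex) set \<Rightarrow> 'v operator_graph" where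
  "restricted_operator A D = (\<lambda>u. (u, A u)) ` D"

definition l2_operator :: "('v \<Rightarrow> real) \<Rightarrow> 'v set \<Rightarrow> 'v operator_graph \<Rightarrow> bool" where
  "l2_operator w V T \<longleftrightarrow>
     T \<subseteq> l2 w V \<times> l2 w V \<and> single_valued T \<and> (\<lambda>x. 0, \<lambda>x. 0) \<in> T \<and>
     (\<forall>(u, y)\<in>T. \<forall>(v, z)\<in>T. (\<lambda>x. u x + v x, \<lambda>x. y x + z x) \<in> T) \<and>
     (\<forall>c. \<forall>(u, y)\<in>T. (\<lambda>x. c * u x, \<lambda>x. c * y x) \<in> T)"

definition l2_densely_defined :: "('v \<Rightarrow> real) \<Rightarrow> 'v set \<Rightarrow> 'v operator_graph \<Rightarrow> bool" where
  "l2_densely_defined w V T \<longleftrightarrow>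
     (\<forall>f\<in>l2 w V. \<forall>\<epsilon>>0. \<exists>u\<in>Domain T. l2_norm w V (\<lambda>x. u x - f x) < \<epsilon>)"

definition l2_symmetric :: "('v \<Rightarrow> real) \<Rightarrow> 'v set \<Rightarrow> 'v operator_graph \<Rightarrow> bool" where
  "l2_symmetric w V T \<longleftrightarrow>
     (\<forall>(u, y)\<in>T. \<forall>(v, z)\<in>T. l2_inner w V y v = l2_inner w V u z)"

definition l2_adjoint :: "('v \<Rightarrow> real) \<Rightarrow> 'v set \<Rightarrow> 'v operator_graph \<Rightarrow> 'v operator_graph" where
  "l2_adjoint w V T =
     {(v, z) \<in> l2 w V \<times> l2 w V. \<forall>(u, y)\<in>T. l2_inner w V y v = l2_inner w V u z}"

definition l2_closure :: "('v \<Rightarrow> real) \<Rightarrow> 'v set \<Rightarrow> 'v operator_graph \<Rightarrow> 'v operator_graph" where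
  "l2_closure w V T =
     {(v, z) \<in> l2 w V \<times> l2 w V.
        \<exists>u y. (\<forall>n::nat. (u n, y n) \<in> T) \<and>
          (\<lambda>n. l2_norm w V (\<lambda>x. u n x - v x)) \<longlonglongrightarrow> 0 \<and>
          (\<lambda>n. l2_norm w V (\<lambda>x. y n x - z x)) \<longlonglongrightarrow> 0}"

definition l2_self_adjoint :: "('v \<Rightarrow> real) \<Rightarrow> 'v set \<Rightarrow> 'v operator_graph \<Rightarrow> bool" where
  "l2_self_adjoint w V T \<longleftrightarrow>
     l2_operator w V T \<and> l2_densely_defined w V T \<and> l2_adjoint w V T = T"

definition l2_essentially_self_adjoint :: "('v \<Rightarrow> real) \<Rightarrow> 'v set \<Rightarrow> 'v operator_graph \<Rightarrow> bool" where
  "l2_essentially_self_adjoint w V T \<longleftrightarrow>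
     l2_operator w V T \<and> l2_densely_defined w V T \<and> l2_symmetric w V T \<and>
     l2_self_adjoint w V (l2_closure w V T)"


section \<open>The magnetic Schroedinger operator\<close>

text \<open>
  The sum is meant for locally finite graphs, where its index set is finite. Off \<open>V\<close> the index
  set is empty, so the result is again a function on \<open>V\<close>.
\<close>

definition magnetic_laplacian ::
  "'v set set \<Rightarrow> ('v \<Rightarrow> real) \<Rightarrow> ('v \<times> 'v \<Rightarrow> real) \<Rightarrow> ('v \<times> 'v \<Rightarrow> complex) \<Rightarrow>
   ('v \<Rightarrow> complex) \<Rightarrow> ('v \<Rightarrow> complex)" where
  "magnetic_laplacian E w a \<sigma> u x =
     1 / complex_of_real (w x) *
     (\<Sum>e\<in>{e \<in> oriented_edges E. fst e = x}.
        complex_of_real (a e) * (u x - \<sigma> (prod.swap e) * u (snd e)))"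

definition magnetic_schroedinger ::
  "'v set set \<Rightarrow> ('v \<Rightarrow> real) \<Rightarrow> ('v \<times> 'v \<Rightarrow> real) \<Rightarrow> ('v \<times> 'v \<Rightarrow> complex) \<Rightarrow> ('v \<Rightarrow> real) \<Rightarrow>
   ('v \<Rightarrow> complex) \<Rightarrow> ('v \<Rightarrow> complex)" where
  "magnetic_schroedinger E w a \<sigma> W u x =
     magnetic_laplacian E w a \<sigma> u x + complex_of_real (W x) * u x"

end

theory Submission
  imports Defs
begin

text \<open>
  Completeness forces metric balls to be finite, as in the Hopf-Rinow theorem, so there are finitely
  supported cutoffs \<open>\<phi>\<close>, equal to \<open>1\<close> on any given finite set, whose variation along an edge is at
  most \<open>\<epsilon>\<close> times the edge length. For \<open>u\<close> in the maximal domain, pairing \<open>H u\<close> with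
  \<open>\<phi>\<^sup>2 q\<^sup>-\<^sup>1 u\<close> bounds the energy \<open>\<Sum> a(e) q\<^sup>-\<^sup>1 \<bar>d u(e)\<bar>\<^sup>2\<close>, where \<open>d\<close> is the
  magnetic difference: \<open>q\<^sup>-\<^sup>1\<close> compensates the potential, and the hypothesis on
  \<open>q\<close> together with the bounded degree controls the commutator. By these energy bounds
  \<open>(H u, \<phi> v) - (\<phi> u, H v)\<close> is of order \<open>\<epsilon>\<close>, so the maximal operator, which is the adjoint of the
  minimal one, is symmetric. Essential self-adjointness follows by the density of the range of
  \<open>H - \<i>\<close>.
\<close>

section \<open>Weighted square-summable functions\<close>

text \<open>The obstacle is that \<open>W\<close> may fall to -\<infinity> as fast as
  -\<open>q\<close>, so finite unweighted energy cannot be expected in the maximal domain, and the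
  usual cutoff argument has nothing to bound its edge terms by. The metric is built to match the
  weight 1/\<open>q\<close> that repairs this. A cutoff \<phi> leaves terms of size a(e)
  |d\<phi>(e)| |du(e)| |v(y)|. The factors sqrt(a) and 1/sqrt(\<open>q\<close>) go with du into the
  weighted energy, the factor sqrt(\<open>w\<close>) goes with v into the norm, and what is left is
  |d\<phi>(e)| divided by the edge length, which is at most \<epsilon>. Cutoffs of slope 1 suffice
  for the energy estimate, where only a bound is wanted; arbitrarily small slopes are reserved for
  symmetry. Finite supports turn every summation by parts into an identity between finite sums, and
  mixed terms are absorbed edge by edge, so no energy has to be known finite in advance.\<close>

definition l2_sq :: "('v \<Rightarrow> real) \<Rightarrow> 'v set \<Rightarrow> ('v \<Rightarrow> complex) \<Rightarrow> real" where
  "l2_sq w V f = (\<Sum>\<^sub>\<infinity>x\<in>V. w x * (cmod (f x))\<^sup>2)"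

lemma cmod_add_sq_le: "(cmod (a + b))\<^sup>2 \<le> 2 * (cmod a)\<^sup>2 + 2 * (cmod b)\<^sup>2"
proof -
  have "(cmod (a + b))\<^sup>2 \<le> (cmod a + cmod b)\<^sup>2"
    by (intro power_mono norm_triangle_ineq norm_ge_zero)
  also have "\<dots> \<le> 2 * (cmod a)\<^sup>2 + 2 * (cmod b)\<^sup>2"
    using sum_squares_bound[of "cmod a" "cmod b"] by (simp add: power2_sum)
  finally show ?thesis .
qed

lemma infsum_minus:
  fixes f g :: "'a \<Rightarrow> complex"
  assumes "f summable_on A" "g summable_on A"
  shows "infsum (\<lambda>x. f x - g x) A = infsum f A - infsum g A"
  using infsum_add[OF assms(1) summable_on_uminus[THEN iffD2, OF assms(2)]] by (simp add: infsum_uminus)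

locale weighted_set =
  fixes w :: "'v \<Rightarrow> real" and V :: "'v set"
  assumes w_pos: "x \<in> V \<Longrightarrow> 0 < w x"
begin

lemma l2_off: "f \<in> l2 w V \<Longrightarrow> x \<notin> V \<Longrightarrow> f x = 0"
  by (auto simp: l2_def vertex_functions_def)

lemma l2_summable: "f \<in> l2 w V \<Longrightarrow> (\<lambda>x. w x * (cmod (f x))\<^sup>2) summable_on V"
  by (auto simp: l2_def)

lemma weighted_sq_nonneg: "x \<in> V \<Longrightarrow> 0 \<le> w x * (cmod z)\<^sup>2"
  using w_pos[of x] by simp

lemma l2I:
  assumes "\<And>x. x \<notin> V \<Longrightarrow> f x = 0" and "g summable_on V"
    and "\<And>x. x \<in> V \<Longrightarrow> w x * (cmod (f x))\<^sup>2 \<le> g x"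
  shows "f \<in> l2 w V"
proof -
  have "(\<lambda>x. w x * (cmod (f x))\<^sup>2) summable_on V"
    by (rule summable_on_comparison_test[OF assms(2)])
      (use assms(3) weighted_sq_nonneg in auto)
  then show ?thesis using assms(1) by (auto simp: l2_def vertex_functions_def)
qed

lemma l2_add:
  assumes "f \<in> l2 w V" "g \<in> l2 w V"
  shows "(\<lambda>x. f x + g x) \<in> l2 w V"
proof (rule l2I)
  show "(\<lambda>x. 2 * (w x * (cmod (f x))\<^sup>2) + 2 * (w x * (cmod (g x))\<^sup>2)) summable_on V"
    by (intro summable_on_add summable_on_cmult_right l2_summable assms)
  show "w x * (cmod (f x + g x))\<^sup>2 \<le> 2 * (w x * (cmod (f x))\<^sup>2) + 2 * (w x * (cmod (g x))\<^sup>2)"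
    if "x \<in> V" for x
    using mult_left_mono[OF cmod_add_sq_le[of "f x" "g x"], of "w x"] w_pos[OF that]
    by (simp add: algebra_simps)
qed (simp add: assms[THEN l2_off])

lemma l2_scale:
  assumes "f \<in> l2 w V"
  shows "(\<lambda>x. c * f x) \<in> l2 w V"
proof (rule l2I)
  show "(\<lambda>x. (cmod c)\<^sup>2 * (w x * (cmod (f x))\<^sup>2)) summable_on V"
    by (intro summable_on_cmult_right l2_summable assms)
qed (use assms l2_off in \<open>auto simp: norm_mult power_mult_distrib\<close>)

lemma l2_diff:
  assumes "f \<in> l2 w V" "g \<in> l2 w V"
  shows "(\<lambda>x. f x - g x) \<in> l2 w V"
  using l2_add[OF assms(1) l2_scale[OF assms(2), of "-1"]] by simp

lemma l2_zero: "(\<lambda>x. 0) \<in> l2 w V"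
  by (auto simp: l2_def vertex_functions_def)

lemma l2_sq_nonneg: "0 \<le> l2_sq w V f"
  unfolding l2_sq_def by (intro infsum_nonneg weighted_sq_nonneg)

section \<open>The inner product and its quadratic form\<close>

lemma l2_inner_summable:
  assumes "f \<in> l2 w V" "g \<in> l2 w V"
  shows "(\<lambda>x. cmod (complex_of_real (w x) * f x * cnj (g x))) summable_on V"
proof (rule summable_on_comparison_test)
  show "(\<lambda>x. (w x * (cmod (f x))\<^sup>2) + (w x * (cmod (g x))\<^sup>2)) summable_on V"
    by (intro summable_on_add l2_summable assms)
  show "cmod (complex_of_real (w x) * f x * cnj (g x))
      \<le> (w x * (cmod (f x))\<^sup>2) + (w x * (cmod (g x))\<^sup>2)" if "x \<in> V" for x
  proof -
    have "2 * cmod (f x) * cmod (g x) \<le> (cmod (f x))\<^sup>2 + (cmod (g x))\<^sup>2"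
      by (rule sum_squares_bound)
    moreover have "0 \<le> cmod (f x) * cmod (g x)" by simp
    ultimately have "cmod (f x) * cmod (g x) \<le> (cmod (f x))\<^sup>2 + (cmod (g x))\<^sup>2" by linarith
    from mult_left_mono[OF this, of "w x"] show ?thesis
      using w_pos[OF that] by (simp add: norm_mult algebra_simps)
  qed
qed auto

lemmas l2_inner_summable' = abs_summable_summable[OF l2_inner_summable]

lemma l2_inner_add_left:
  assumes "f \<in> l2 w V" "g \<in> l2 w V" "h \<in> l2 w V"
  shows "l2_inner w V (\<lambda>x. f x + g x) h = l2_inner w V f h + l2_inner w V g h"
  unfolding l2_inner_def
  using infsum_add[OF l2_inner_summable'[OF assms(1,3)] l2_inner_summable'[OF assms(2,3)]]
  by (simp add: algebra_simps)

lemma l2_inner_scale_left: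
  "l2_inner w V (\<lambda>x. c * f x) h = c * l2_inner w V f h"
  unfolding l2_inner_def infsum_cmult_right'[symmetric] by (simp add: algebra_simps)

lemma l2_inner_cnj: "l2_inner w V g f = cnj (l2_inner w V f g)"
  unfolding l2_inner_def infsum_cnj[symmetric] by (simp add: algebra_simps)

lemma l2_inner_add_right:
  assumes "f \<in> l2 w V" "g \<in> l2 w V" "h \<in> l2 w V"
  shows "l2_inner w V h (\<lambda>x. f x + g x) = l2_inner w V h f + l2_inner w V h g"
  using l2_inner_add_left[OF assms] by (metis l2_inner_cnj complex_cnj_add)

lemma l2_inner_scale_right:
  "l2_inner w V h (\<lambda>x. c * f x) = cnj c * l2_inner w V h f"
  using l2_inner_scale_left[of c f h] by (metis l2_inner_cnj complex_cnj_mult)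

lemma l2_inner_self: "l2_inner w V f f = complex_of_real (l2_sq w V f)"
proof -
  have "complex_of_real (w x) * f x * cnj (f x) = complex_of_real (w x * (cmod (f x))\<^sup>2)" for x
    by (simp add: mult.assoc flip: complex_norm_square)
  moreover have "infsum (\<lambda>x. complex_of_real (h x)) V = complex_of_real (infsum h V)" for h
  proof (cases "h summable_on V")
    case True
    then show ?thesis by (intro infsumI) (simp add: has_sum_of_real_iff)
  next
    case False
    \<comment> \<open>A divergent \<open>infsum\<close> is 0 by convention. The complex series
      diverges together with the real one, as its real part shows, so both sides are 0.\<close>
    then have "\<not> (\<lambda>x. complex_of_real (h x)) summable_on V"
      using summable_on_Re[of "\<lambda>x. complex_of_real (h x)" V] by auto
    with False show ?thesis by (simp add: infsum_not_exists)
  qed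
  ultimately show ?thesis unfolding l2_inner_def l2_sq_def by (simp only:)
qed

lemma l2_norm_eq: "l2_norm w V f = sqrt (l2_sq w V f)"
  by (simp add: l2_norm_def l2_inner_self)

lemma l2_sq_scale: "l2_sq w V (\<lambda>x. c * f x) = (cmod c)\<^sup>2 * l2_sq w V f"
  unfolding l2_sq_def infsum_cmult_right'[symmetric]
  by (simp add: norm_mult power_mult_distrib algebra_simps)

lemma l2_sq_minus_commute: "l2_sq w V (\<lambda>x. f x - g x) = l2_sq w V (\<lambda>x. g x - f x)"
  by (simp add: l2_sq_def norm_minus_commute)

text \<open>This one expansion serves the parallelogram law (\<open>t\<close> = 1 and -1), the
  Cauchy-Schwarz inequality, the variational argument for orthogonality, and the norm of
  \<open>H u\<close> - \<open>\<i>\<close> \<open>u\<close>.\<close>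

lemma l2_sq_add_scaled:
  assumes "f \<in> l2 w V" "g \<in> l2 w V"
  shows "l2_sq w V (\<lambda>x. f x + t * g x)
    = l2_sq w V f + 2 * Re (cnj t * l2_inner w V f g) + (cmod t)\<^sup>2 * l2_sq w V g"
proof -
  let ?I = "l2_inner w V"
  note tg = l2_scale[OF assms(2), of t]
  have 1: "?I (\<lambda>x. f x + t * g x) (\<lambda>x. f x + t * g x)
      = ?I f f + cnj t * ?I f g + t * ?I g f + t * cnj t * ?I g g"
    using l2_inner_add_left[OF assms(1) tg l2_add[OF assms(1) tg]]
      l2_inner_add_right[OF assms(1) tg assms(1)] l2_inner_add_right[OF assms(1) tg tg]
    by (simp add: l2_inner_scale_left l2_inner_scale_right algebra_simps)
  have 2: "t * ?I g f = cnj (cnj t * ?I f g)" by (simp add: l2_inner_cnj[of g f])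
  have "Re (?I (\<lambda>x. f x + t * g x) (\<lambda>x. f x + t * g x))
      = l2_sq w V f + 2 * Re (cnj t * ?I f g) + (cmod t)\<^sup>2 * l2_sq w V g"
    unfolding 1 2 by (simp add: l2_inner_self flip: complex_norm_square)
  then show ?thesis by (simp add: l2_inner_self)
qed

lemma l2_parallelogram:
  assumes "f \<in> l2 w V" "g \<in> l2 w V"
  shows "l2_sq w V (\<lambda>x. f x + g x) + l2_sq w V (\<lambda>x. f x - g x) = 2 * l2_sq w V f + 2 * l2_sq w V g"
  using l2_sq_add_scaled[OF assms, of 1] l2_sq_add_scaled[OF assms, of "-1"] by simp

lemma l2_sq_point:
  assumes "f \<in> l2 w V" "x \<in> V"
  shows "w x * (cmod (f x))\<^sup>2 \<le> l2_sq w V f"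
proof -
  have "sum (\<lambda>x. w x * (cmod (f x))\<^sup>2) {x} \<le> l2_sq w V f"
    unfolding l2_sq_def
    by (rule finite_sum_le_infsum[OF l2_summable[OF assms(1)]])
      (use assms(2) weighted_sq_nonneg in auto)
  then show ?thesis by simp
qed

lemma l2_sq_eq_0:
  assumes "f \<in> l2 w V" "l2_sq w V f = 0"
  shows "f = (\<lambda>x. 0)"
proof
  fix x show "f x = 0"
    using l2_sq_point[OF assms(1), of x] w_pos[of x] assms(2) l2_off[OF assms(1), of x]
    by (cases "x \<in> V") (auto simp: mult_le_0_iff)
qed

lemma l2_Cauchy_Schwarz:
  assumes "f \<in> l2 w V" "g \<in> l2 w V"
  shows "(cmod (l2_inner w V f g))\<^sup>2 \<le> l2_sq w V f * l2_sq w V g"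
proof (cases "l2_sq w V g = 0")
  case True
  then show ?thesis using l2_sq_eq_0[OF assms(2)] by (simp add: l2_inner_def)
next
  case False
  let ?c = "l2_inner w V f g" and ?G = "l2_sq w V g"
  have pos: "?G > 0" using False l2_sq_nonneg[of g] by simp
  \<comment> \<open>The coefficient is the minimiser of the quadratic: it removes from
    \<open>f\<close> its projection onto \<open>g\<close>.\<close>
  have "0 \<le> l2_sq w V (\<lambda>x. f x + (- ?c / of_real ?G) * g x)" by (rule l2_sq_nonneg)
  also have "\<dots> = l2_sq w V f + 2 * Re (cnj (- ?c / of_real ?G) * ?c) + (cmod (- ?c / of_real ?G))\<^sup>2 * ?G"
    by (rule l2_sq_add_scaled[OF assms])
  also have "cnj (- ?c / of_real ?G) * ?c = complex_of_real (- (cmod ?c)\<^sup>2 / ?G)"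
    using complex_norm_square[of ?c] by (simp add: mult.commute)
  also have "(cmod (- ?c / of_real ?G))\<^sup>2 * ?G = (cmod ?c)\<^sup>2 / ?G"
    using pos by (simp add: norm_divide power_divide power2_eq_square)
  finally have "(cmod ?c)\<^sup>2 / ?G \<le> l2_sq w V f" by simp
  then show ?thesis using pos by (simp add: divide_le_eq)
qed

text \<open>Fatou's lemma for a weighted counting measure: each finite partial sum passes to the
  limit and keeps the bound \<open>B\<close>. It stands in for completeness of the space
  below.\<close>

lemma l2_Fatou:
  assumes g: "\<And>n::nat. g n \<in> l2 w V" and lim: "\<And>x. (\<lambda>n. g n x) \<longlonglongrightarrow> h x"
    and B: "\<And>n. l2_sq w V (g n) \<le> B"
  shows "h \<in> l2 w V" "l2_sq w V h \<le> B"
proof -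
  have fin: "(\<Sum>x\<in>F. w x * (cmod (h x))\<^sup>2) \<le> B" if F: "finite F" "F \<subseteq> V" for F
  proof (rule LIMSEQ_le_const2)
    show "(\<lambda>n. \<Sum>x\<in>F. w x * (cmod (g n x))\<^sup>2) \<longlonglongrightarrow> (\<Sum>x\<in>F. w x * (cmod (h x))\<^sup>2)"
      by (intro tendsto_intros lim)
    have "(\<Sum>x\<in>F. w x * (cmod (g n x))\<^sup>2) \<le> B" for n
    proof -
      have "(\<Sum>x\<in>F. w x * (cmod (g n x))\<^sup>2) \<le> l2_sq w V (g n)"
        unfolding l2_sq_def
        by (rule finite_sum_le_infsum[OF l2_summable[OF g] F])
          (use weighted_sq_nonneg in auto)
      with B[of n] show ?thesis by simp
    qed
    then show "\<exists>N. \<forall>n\<ge>N. (\<Sum>x\<in>F. w x * (cmod (g n x))\<^sup>2) \<le> B" by blast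
  qed
  have "h x = 0" if "x \<notin> V" for x
    using lim[of x] l2_off[OF g that] LIMSEQ_unique by (simp add: LIMSEQ_const_iff)
  moreover have s: "(\<lambda>x. w x * (cmod (h x))\<^sup>2) summable_on V"
    by (rule nonneg_bdd_above_summable_on)
      (use weighted_sq_nonneg fin in \<open>auto intro!: bdd_aboveI2\<close>)
  ultimately show "h \<in> l2 w V" by (auto simp: l2_def vertex_functions_def)
  show "l2_sq w V h \<le> B"
    unfolding l2_sq_def by (rule infsum_le_finite_sums[OF s fin])
qed

text \<open>Each point of \<open>V\<close> has positive mass, so the norm controls every single
  value.\<close>

lemma l2_tendsto_pointwise:
  assumes g: "\<And>n::nat. g n \<in> l2 w V" and h: "h \<in> l2 w V"
    and lim: "(\<lambda>n. l2_sq w V (\<lambda>x. g n x - h x)) \<longlonglongrightarrow> 0"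
  shows "(\<lambda>n. g n x) \<longlonglongrightarrow> h x"
proof (cases "x \<in> V")
  case False
  then show ?thesis using l2_off[OF g False] l2_off[OF h False] by simp
next
  case True
  have "(\<lambda>n. l2_sq w V (\<lambda>x. g n x - h x) / w x) \<longlonglongrightarrow> 0 / w x"
    by (rule tendsto_divide[OF lim tendsto_const]) (use w_pos[OF True] in simp)
  then have lim': "(\<lambda>n. l2_sq w V (\<lambda>x. g n x - h x) / w x) \<longlonglongrightarrow> 0" by simp
  have "(\<lambda>n. (cmod (g n x - h x))\<^sup>2) \<longlonglongrightarrow> 0"
  proof (rule tendsto_sandwich[OF _ _ tendsto_const lim'])
    show "\<forall>\<^sub>F n in sequentially. (cmod (g n x - h x))\<^sup>2 \<le> l2_sq w V (\<lambda>x. g n x - h x) / w x"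
      using l2_sq_point[OF l2_diff[OF g h] True] w_pos[OF True]
      by (simp add: le_divide_eq mult.commute)
  qed simp
  then have "(\<lambda>n. sqrt ((cmod (g n x - h x))\<^sup>2)) \<longlonglongrightarrow> sqrt 0" by (rule tendsto_real_sqrt)
  then have "(\<lambda>n. g n x - h x) \<longlonglongrightarrow> 0" by (simp add: tendsto_norm_zero_iff)
  then show ?thesis by (simp add: LIM_zero_iff)
qed

text \<open>The projection theorem in sequence form. \<open>M\<close> need not be closed, so the
  distance from \<open>g\<close> to \<open>M\<close> need not be attained; instead the residuals of
  a minimising sequence converge to a vector orthogonal to \<open>M\<close>, which must
  vanish.\<close>

lemma l2_dense_if_orthogonal_trivial:
  assumes M: "M \<subseteq> l2 w V" and M0: "M \<noteq> {}"
    and add: "\<And>f g. f \<in> M \<Longrightarrow> g \<in> M \<Longrightarrow> (\<lambda>x. f x + g x) \<in> M"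
    and scale: "\<And>c f. f \<in> M \<Longrightarrow> (\<lambda>x. c * f x) \<in> M"
    and orth: "\<And>s. s \<in> l2 w V \<Longrightarrow> (\<And>f. f \<in> M \<Longrightarrow> l2_inner w V s f = 0) \<Longrightarrow> s = (\<lambda>x. 0)"
    and g: "g \<in> l2 w V"
  shows "\<exists>m. (\<forall>n::nat. m n \<in> M) \<and> (\<lambda>n. l2_sq w V (\<lambda>x. g x - m n x)) \<longlonglongrightarrow> 0"
proof -
  define Q where "Q m = l2_sq w V (\<lambda>x. g x - m x)" for m
  define d where "d = Inf (Q ` M)"
  have bdd: "bdd_below (Q ` M)"
    by (rule bdd_belowI2[of _ 0]) (simp add: Q_def l2_sq_nonneg)
  have d: "d \<le> Q m" if "m \<in> M" for m
    unfolding d_def using that bdd by (intro cInf_lower) auto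
  have "\<exists>m\<in>M. Q m < d + 1 / (real n + 1)" for n
    using cInf_lessD[of "Q ` M" "d + 1 / (real n + 1)"] M0 unfolding d_def by auto
  then obtain m where m: "\<And>n. m n \<in> M" "\<And>n. Q (m n) < d + 1 / (real n + 1)" by metis
  define s where "s n = (\<lambda>x. g x - m n x)" for n
  have sl: "s n \<in> l2 w V" for n unfolding s_def using l2_diff[OF g] m(1) M by blast
  have sd: "l2_sq w V (s n) < d + 1 / (real n + 1)" for n using m(2)[of n] by (simp add: Q_def s_def)
  \<comment> \<open>The midpoint of \<open>m n\<close> and \<open>m k\<close> lies in
    \<open>M\<close>, so the sum of the two residuals has square norm at least 4 \<open>d\<close>;
    the parallelogram law then leaves only the errors 1/(n+1) and 1/(k+1).\<close>
  have cau: "l2_sq w V (\<lambda>x. s n x - s k x) \<le> 2 / (real n + 1) + 2 / (real k + 1)" for n k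
  proof -
    let ?m = "\<lambda>x. 1/2 * (m n x + m k x)"
    have "d \<le> Q ?m" by (intro d scale add m)
    also have "Q ?m = l2_sq w V (\<lambda>x. 1/2 * (s n x + s k x))"
      by (simp add: Q_def s_def algebra_simps)
    also have "\<dots> = 1/4 * l2_sq w V (\<lambda>x. s n x + s k x)"
      by (subst l2_sq_scale) (simp add: power2_eq_square)
    finally show ?thesis
      using l2_parallelogram[OF sl sl, of n k] sd[of n] sd[of k] by simp
  qed
  have inv0: "(\<lambda>n. c / (real n + 1)) \<longlonglongrightarrow> 0" for c
    using tendsto_mult[OF tendsto_const[of c] LIMSEQ_inverse_real_of_nat]
    by (simp add: divide_inverse add.commute)
  have conv: "convergent (\<lambda>n. s n x)" for x
  proof (cases "x \<in> V")
    case False then show ?thesis using l2_off[OF sl] by (simp add: convergent_const)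
  next
    case True
    have "Cauchy (\<lambda>n. s n x)"
    proof (rule metric_CauchyI)
      fix e :: real assume e: "0 < e"
      then have "0 < w x * e\<^sup>2" using w_pos[OF True] by simp
      then have "\<forall>\<^sub>F n in sequentially. 4 / (real n + 1) < w x * e\<^sup>2"
        using inv0[of 4] by (simp add: order_tendstoD)
      then obtain N where N: "\<And>n. n \<ge> N \<Longrightarrow> 4 / (real n + 1) < w x * e\<^sup>2"
        by (auto simp: eventually_sequentially)
      have "dist (s n x) (s k x) < e" if "n \<ge> N" "k \<ge> N" for n k
      proof -
        have "w x * (cmod (s n x - s k x))\<^sup>2 \<le> 2 / (real n + 1) + 2 / (real k + 1)"
          using l2_sq_point[OF l2_diff[OF sl sl] True, of n k] cau[of n k] by simp
        also have "\<dots> < w x * e\<^sup>2" using N[OF that(1)] N[OF that(2)] by linarith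
        finally have "(cmod (s n x - s k x))\<^sup>2 < e\<^sup>2" using w_pos[OF True] by simp
        then show ?thesis using e by (simp add: dist_norm power_less_imp_less_base)
      qed
      then show "\<exists>N. \<forall>m\<ge>N. \<forall>n\<ge>N. dist (s m x) (s n x) < e" by blast
    qed
    then show ?thesis by (simp add: Cauchy_convergent_iff)
  qed
  define t where "t x = lim (\<lambda>n. s n x)" for x
  have t: "(\<lambda>n. s n x) \<longlonglongrightarrow> t x" for x
    unfolding t_def using conv by (simp add: convergent_LIMSEQ_iff)
  \<comment> \<open>Letting \<open>k\<close> tend to infinity in the Cauchy estimate gives both
    membership and rate by \<open>l2_Fatou\<close>.\<close>
  have F: "(\<lambda>x. s n x - t x) \<in> l2 w V" "l2_sq w V (\<lambda>x. s n x - t x) \<le> 4 / (real n + 1)" for n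
  proof -
    have lim: "(\<lambda>k. s n x - s (n + k) x) \<longlonglongrightarrow> s n x - t x" for x
      by (intro tendsto_diff tendsto_const) (use LIMSEQ_ignore_initial_segment[OF t, of n] in \<open>simp add: add.commute\<close>)
    have le: "l2_sq w V (\<lambda>x. s n x - s (n + k) x) \<le> 4 / (real n + 1)" for k
    proof -
      have "2 / (real (n + k) + 1) \<le> 2 / (real n + 1)" by (intro divide_left_mono) auto
      then show ?thesis using cau[of n "n + k"] by simp
    qed
    show "(\<lambda>x. s n x - t x) \<in> l2 w V" "l2_sq w V (\<lambda>x. s n x - t x) \<le> 4 / (real n + 1)"
      using l2_Fatou[where g="\<lambda>k x. s n x - s (n + k) x", OF l2_diff[OF sl sl] lim le] by auto
  qed
  have tl: "t \<in> l2 w V" using l2_diff[OF sl[of 0] F(1)[of 0]] by simp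
  have "l2_inner w V t f = 0" if f: "f \<in> M" for f
  proof -
    have fl: "f \<in> l2 w V" using f M by auto
    define P where "P = l2_sq w V f"
    define c where "c = l2_inner w V t f"
    have P0: "0 \<le> P" unfolding P_def by (rule l2_sq_nonneg)
    have split: "l2_inner w V (s n) f = l2_inner w V (\<lambda>x. s n x - t x) f + c" for n
      using l2_inner_add_left[OF F(1)[of n] tl fl] by (simp add: c_def)
    have "(\<lambda>n. (cmod (l2_inner w V (\<lambda>x. s n x - t x) f))\<^sup>2) \<longlonglongrightarrow> 0"
    proof (rule tendsto_sandwich[OF _ _ tendsto_const inv0[of "4 * P"]])
      show "\<forall>\<^sub>F n in sequentially. (cmod (l2_inner w V (\<lambda>x. s n x - t x) f))\<^sup>2 \<le> 4 * P / (real n + 1)"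
      proof (rule always_eventually, rule allI)
        fix n
        have "l2_sq w V (\<lambda>x. s n x - t x) * P \<le> 4 / (real n + 1) * P"
          using F(2)[of n] P0 by (rule mult_right_mono)
        then show "(cmod (l2_inner w V (\<lambda>x. s n x - t x) f))\<^sup>2 \<le> 4 * P / (real n + 1)"
          using l2_Cauchy_Schwarz[OF F(1)[of n] fl] by (simp add: P_def)
      qed
    qed simp
    then have "(\<lambda>n. sqrt ((cmod (l2_inner w V (\<lambda>x. s n x - t x) f))\<^sup>2)) \<longlonglongrightarrow> sqrt 0"
      by (rule tendsto_real_sqrt)
    then have "(\<lambda>n. l2_inner w V (\<lambda>x. s n x - t x) f) \<longlonglongrightarrow> 0" by (simp add: tendsto_norm_zero_iff)
    from tendsto_add[OF this tendsto_const[of c]]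
    have clim: "(\<lambda>n. l2_inner w V (s n) f) \<longlonglongrightarrow> c" by (simp add: split)
    \<comment> \<open>Moving \<open>m n\<close> by a multiple of \<open>f\<close> stays in
      \<open>M\<close> and cannot push the square distance below \<open>d\<close>; the defect
      1/(n+1) disappears in the limit.\<close>
    have ineq: "0 \<le> 2 * Re (cnj z * c) + (cmod z)\<^sup>2 * P" for z
    proof (rule LIMSEQ_le)
      show "(\<lambda>n. - 1 / (real n + 1)) \<longlonglongrightarrow> 0" by (rule inv0)
      show "(\<lambda>n. 2 * Re (cnj z * l2_inner w V (s n) f) + (cmod z)\<^sup>2 * P)
          \<longlonglongrightarrow> 2 * Re (cnj z * c) + (cmod z)\<^sup>2 * P"
        by (intro tendsto_intros clim)
      have "- 1 / (real n + 1) \<le> 2 * Re (cnj z * l2_inner w V (s n) f) + (cmod z)\<^sup>2 * P" for n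
      proof -
        have "d \<le> Q (\<lambda>x. m n x + (-z) * f x)" by (intro d add m scale f)
        also have "\<dots> = l2_sq w V (\<lambda>x. s n x + z * f x)" by (simp add: Q_def s_def algebra_simps)
        also have "\<dots> = l2_sq w V (s n) + 2 * Re (cnj z * l2_inner w V (s n) f) + (cmod z)\<^sup>2 * P"
          unfolding P_def by (rule l2_sq_add_scaled[OF sl fl])
        finally show ?thesis using sd[of n] by simp
      qed
      then show "\<exists>N. \<forall>n\<ge>N. - 1 / (real n + 1) \<le> 2 * Re (cnj z * l2_inner w V (s n) f) + (cmod z)\<^sup>2 * P"
        by blast
    qed
    \<comment> \<open>At \<open>z\<close> = -\<open>r\<close> \<open>c\<close> the linear term is -2
      \<open>r\<close> |c|^2 and the quadratic one at most \<open>r\<close> |c|^2, since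
      \<open>r * P\<close> < 1. The summand 1 in the denominator covers \<open>P\<close> =
      0.\<close>
    define r where "r = 1 / (1 + P)"
    have r: "0 < r" "r * P < 1" using P0 by (auto simp: r_def)
    have "0 \<le> 2 * Re (cnj (- of_real r * c) * c) + (cmod (- of_real r * c))\<^sup>2 * P" by (rule ineq)
    also have "cnj (- of_real r * c) * c = of_real (- r * (cmod c)\<^sup>2)"
      using complex_norm_square[of c] by (simp add: mult.commute mult.left_commute)
    also have "(cmod (- of_real r * c))\<^sup>2 = r\<^sup>2 * (cmod c)\<^sup>2"
      by (simp add: norm_mult power_mult_distrib)
    finally have "0 \<le> r * (cmod c)\<^sup>2 * (r * P - 2)" by (simp add: power2_eq_square algebra_simps)
    then have "(cmod c)\<^sup>2 \<le> 0" using r by (auto simp: zero_le_mult_iff mult_le_0_iff)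
    then show ?thesis by (simp add: c_def)
  qed
  then have t0: "t = (\<lambda>x. 0)" by (intro orth tl)
  have "(\<lambda>n. l2_sq w V (\<lambda>x. g x - m n x)) \<longlonglongrightarrow> 0"
  proof (rule tendsto_sandwich[OF _ _ tendsto_const inv0[of 4]])
    show "\<forall>\<^sub>F n in sequentially. l2_sq w V (\<lambda>x. g x - m n x) \<le> 4 / (real n + 1)"
      using F(2) by (simp add: t0 s_def)
  qed (simp add: l2_sq_nonneg)
  with m(1) show ?thesis by blast
qed

section \<open>Finitely supported functions and their density\<close>

lemma finitely_supported_l2: "finitely_supported V \<subseteq> l2 w V"
proof
  fix f assume f: "f \<in> finitely_supported V"
  then have "(\<lambda>x. w x * (cmod (f x))\<^sup>2) summable_on {x \<in> V. f x \<noteq> 0}"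
    by (simp add: finitely_supported_def)
  also have "?this \<longleftrightarrow> (\<lambda>x. w x * (cmod (f x))\<^sup>2) summable_on V"
    by (rule summable_on_cong_neutral) auto
  finally show "f \<in> l2 w V" using f by (simp add: l2_def finitely_supported_def)
qed

lemma finitely_supported_dense:
  assumes f: "f \<in> l2 w V" and e: "0 < e"
  shows "\<exists>u\<in>finitely_supported V. l2_norm w V (\<lambda>x. u x - f x) < e"
proof -
  have "0 < e\<^sup>2" using e by simp
  from infsum_finite_approximation[OF l2_summable[OF f] half_gt_zero[OF this]]
  obtain F where F: "finite F" "F \<subseteq> V" "dist (\<Sum>x\<in>F. w x * (cmod (f x))\<^sup>2) (l2_sq w V f) \<le> e\<^sup>2 / 2"
    unfolding l2_sq_def by blast
  let ?u = "\<lambda>x. if x \<in> F then f x else 0"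
  have "l2_sq w V (\<lambda>x. ?u x - f x) = (\<Sum>\<^sub>\<infinity>x\<in>V - F. w x * (cmod (f x))\<^sup>2)"
    unfolding l2_sq_def by (rule infsum_cong_neutral) auto
  also have "\<dots> = l2_sq w V f - (\<Sum>x\<in>F. w x * (cmod (f x))\<^sup>2)"
    unfolding l2_sq_def using infsum_Diff[OF l2_summable[OF f] _ F(2)] F(1) by simp
  also have "\<dots> \<le> e\<^sup>2 / 2" using abs_le_D2[OF F(3)[unfolded dist_real_def]] by simp
  also have "\<dots> < e\<^sup>2" using e by simp
  finally have "l2_norm w V (\<lambda>x. ?u x - f x) < e"
    unfolding l2_norm_eq using e by (simp add: real_less_lsqrt)
  moreover have "?u \<in> finitely_supported V"
    using F(1,2) by (auto simp: finitely_supported_def vertex_functions_def)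
  ultimately show ?thesis by (intro bexI[of _ ?u])
qed

end

section \<open>Completeness and cutoff functions\<close>

lemma oriented_edges_iff: "(x, y) \<in> oriented_edges E \<longleftrightarrow> {x, y} \<in> E"
  by (simp add: oriented_edges_def)

lemma oriented_edges_swap: "prod.swap e \<in> oriented_edges E \<longleftrightarrow> e \<in> oriented_edges E"
  by (cases e) (simp add: oriented_edges_iff insert_commute)

locale locally_finite_graph = weighted_set w V
  for w :: "'v \<Rightarrow> real" and V :: "'v set" +
  fixes E :: "'v set set" and a :: "'v \<times> 'v \<Rightarrow> real" and q :: "'v \<Rightarrow> real" and N :: nat
  assumes simple: "simple_graph V E"
    and degree: "x \<in> V \<Longrightarrow> finite {e \<in> E. x \<in> e} \<and> card {e \<in> E. x \<in> e} \<le> N"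
    and a_pos: "e \<in> oriented_edges E \<Longrightarrow> 0 < a e"
    and q_ge_1: "x \<in> V \<Longrightarrow> 1 \<le> q x"
begin

section \<open>Local finiteness, edge lengths and path distance\<close>

lemma edgeD:
  assumes "{x, y} \<in> E"
  shows "x \<in> V" "y \<in> V" "x \<noteq> y"
  using assms simple unfolding simple_graph_def by (fastforce simp: doubleton_eq_iff)+

definition edges_from :: "'v \<Rightarrow> ('v \<times> 'v) set" where
  "edges_from x = {e \<in> oriented_edges E. fst e = x}"

lemma edges_from_off: "x \<notin> V \<Longrightarrow> edges_from x = {}"
  using edgeD by (fastforce simp: edges_from_def oriented_edges_def)

lemma edges_from_finite: "finite (edges_from x)" and card_edges_from: "card (edges_from x) \<le> N"
proof -
  have "finite (edges_from x) \<and> card (edges_from x) \<le> N"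
  proof (cases "x \<in> V")
    case True
    have inj: "inj_on (\<lambda>e. {fst e, snd e}) (edges_from x)"
      by (auto simp: inj_on_def edges_from_def doubleton_eq_iff)
    have sub: "(\<lambda>e. {fst e, snd e}) ` edges_from x \<subseteq> {e \<in> E. x \<in> e}"
      by (auto simp: edges_from_def oriented_edges_def)
    show ?thesis
      using degree[OF True] card_inj_on_le[OF inj sub] inj_on_finite[OF inj sub] by auto
  next
    case False
    then show ?thesis by (simp add: edges_from_off)
  qed
  then show "finite (edges_from x)" "card (edges_from x) \<le> N" by auto
qed

lemma finite_neighbours: "finite {z. {x, z} \<in> E}"
proof -
  have "{z. {x, z} \<in> E} = snd ` edges_from x"
    by (force simp: edges_from_def oriented_edges_def)
  then show ?thesis by (simp add: edges_from_finite)
qed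

definition edge_length :: "'v \<Rightarrow> 'v \<Rightarrow> real" where
  "edge_length x y = min (sqrt (w x)) (sqrt (w y)) * min (1 / sqrt (q x)) (1 / sqrt (q y)) / sqrt (a (x, y))"

lemma edge_length_pos:
  assumes "{x, y} \<in> E"
  shows "0 < edge_length x y"
  using edgeD[OF assms] w_pos[of x] w_pos[of y] q_ge_1[of x] q_ge_1[of y] a_pos[of "(x, y)"] assms
  by (auto simp: edge_length_def oriented_edges_iff min_def)

lemma path_weight_Cons:
  "path_weight w a q (x # y # p) = edge_length x y + path_weight w a q (y # p)"
  by (simp add: path_weight_def edge_length_def sum.lessThan_Suc_shift del: sum.lessThan_Suc)

lemma graph_path_Cons:
  "graph_path V E x (x' # y # p) z \<longleftrightarrow> x' = x \<and> {x, y} \<in> E \<and> graph_path V E y (y # p) z"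
proof -
  have all_Suc: "(\<forall>j. Q j) \<longleftrightarrow> Q 0 \<and> (\<forall>j. Q (Suc j))" for Q :: "nat \<Rightarrow> bool"
    by (metis not0_implies_Suc)
  have "(\<forall>j. Suc j < length (x # y # p) \<longrightarrow> {(x # y # p) ! j, (x # y # p) ! Suc j} \<in> E) \<longleftrightarrow>
    {x, y} \<in> E \<and> (\<forall>j. Suc j < length (y # p) \<longrightarrow> {(y # p) ! j, (y # p) ! Suc j} \<in> E)"
    by (subst all_Suc) auto
  then show ?thesis using edgeD[of x y] by (auto simp: graph_path_def)
qed

lemma path_weight_nonneg: "graph_path V E x p y \<Longrightarrow> 0 \<le> path_weight w a q p"
proof (induction p arbitrary: x)
  case Nil
  then show ?case by (simp add: graph_path_def)
next
  case (Cons z p)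
  show ?case
  proof (cases p)
    case Nil
    then show ?thesis by (simp add: path_weight_def)
  next
    case (Cons z' p')
    with Cons.prems have "{x, z'} \<in> E" "graph_path V E z' p y" "z = x"
      by (auto simp: graph_path_Cons)
    with Cons.IH show ?thesis
      using edge_length_pos[of x z'] Cons by (fastforce simp: path_weight_Cons)
  qed
qed

abbreviation dist_G :: "'v \<Rightarrow> 'v \<Rightarrow> real" where
  "dist_G \<equiv> path_dist V E w a q"

lemma dist_le_path_weight:
  assumes "graph_path V E x p y"
  shows "dist_G x y \<le> path_weight w a q p"
proof -
  have "x \<in> V" "y \<in> V" using assms by (auto simp: graph_path_def)
  moreover have "Inf (path_weight w a q ` {p. graph_path V E x p y}) \<le> path_weight w a q p"
    using assms path_weight_nonneg by (intro cInf_lower bdd_belowI2[of _ 0]) auto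
  ultimately show ?thesis by (simp add: path_dist_def)
qed

lemma dist_le_edge_length:
  assumes "{x, y} \<in> E"
  shows "dist_G x y \<le> edge_length x y"
proof -
  have "graph_path V E x [x, y] y"
    using assms edgeD[OF assms] by (simp add: graph_path_def)
  from dist_le_path_weight[OF this] show ?thesis
    by (simp add: path_weight_Cons) (simp add: path_weight_def)
qed

end

locale complete_weighted_graph = locally_finite_graph w V E a q N
  for w :: "'v \<Rightarrow> real" and V E a q N +
  assumes connected: "connected_graph V E"
    and metric: "Metric_space V (path_dist V E w a q)"
    and complete: "Metric_space.mcomplete V (path_dist V E w a q)"
begin

interpretation G: Metric_space V dist_G by (rule metric)

text \<open>The infimum over paths need not be attained, so the claim is phrased with a strict bound
  \<open>r\<close>: some path already has weight below \<open>r\<close>, and removing its first edge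
  leaves a path from \<open>z\<close>. The condition \<open>x\<close> \<noteq> \<open>y\<close>
  rules out the one-vertex path.\<close>

lemma dist_first_step:
  assumes V: "x \<in> V" "y \<in> V" "x \<noteq> y" and r: "dist_G x y < r"
  shows "\<exists>z. {x, z} \<in> E \<and> dist_G z y < r - edge_length x z"
proof -
  have "{p. graph_path V E x p y} \<noteq> {}" using connected V by (auto simp: connected_graph_def)
  then obtain p where p: "graph_path V E x p y" "path_weight w a q p < r"
    using cInf_lessD[of "path_weight w a q ` {p. graph_path V E x p y}" r] r V
    by (auto simp: path_dist_def)
  obtain z p' where "p = x # z # p'"
    using p(1) \<open>x \<noteq> y\<close> by (cases p rule: remdups_adj.cases) (auto simp: graph_path_def)
  with p have "{x, z} \<in> E" "graph_path V E z (z # p') y"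
    "edge_length x z + path_weight w a q (z # p') < r"
    by (auto simp: graph_path_Cons path_weight_Cons)
  with dist_le_path_weight[of z "z # p'" y] show ?thesis by fastforce
qed

text \<open>A path leaving \<open>x\<close> begins with one of finitely many edges, each of positive
  length.\<close>

lemma vertex_isolated:
  assumes "x \<in> V"
  shows "\<exists>\<delta>>0. \<forall>y\<in>V. y \<noteq> x \<longrightarrow> \<delta> \<le> dist_G x y"
proof (intro exI conjI ballI impI)
  \<comment> \<open>The 1 keeps \<open>Min\<close> meaningful when \<open>x\<close> has no
    neighbour.\<close>
  let ?\<delta> = "Min (insert 1 (edge_length x ` {z. {x, z} \<in> E}))"
  show "0 < ?\<delta>" using edge_length_pos finite_neighbours by auto
  fix y assume y: "y \<in> V" "y \<noteq> x"
  show "?\<delta> \<le> dist_G x y"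
  proof (rule ccontr)
    assume "\<not> ?thesis"
    then have "dist_G x y < ?\<delta>" by simp
    from dist_first_step[OF assms y(1) y(2)[symmetric] this]
    obtain z where z: "{x, z} \<in> E" "dist_G z y < ?\<delta> - edge_length x z" by blast
    then have "?\<delta> \<le> edge_length x z" using finite_neighbours by (intro Min_le) auto
    with z(2) G.nonneg[of z y] show False by linarith
  qed
qed

text \<open>
  If a ball were infinite, some neighbour of its centre would again be the centre of an infinite
  ball, of radius smaller by at least the edge length. Iterating gives a path of finite total
  length, which converges; but vertices are isolated, while consecutive vertices differ.
\<close>

lemma finite_balls:
  assumes "x0 \<in> V"
  shows "finite {y \<in> V. dist_G x0 y < r}"
proof (rule ccontr)
  \<comment> \<open>A state is a vertex with a remaining radius. The radius lost along the sequence
    is the length of the path walked so far.\<close>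
  define bad where "bad = (\<lambda>(x, r). x \<in> V \<and> infinite {y \<in> V. dist_G x y < r})"
  assume "\<not> ?thesis"
  then have bad0: "bad (x0, r)" using assms by (simp add: bad_def)
  have step: "\<exists>t. bad t \<and> {fst s, fst t} \<in> E \<and> snd t = snd s - edge_length (fst s) (fst t)"
    if s: "bad s" for s
  proof (rule ccontr)
    assume none: "\<not> ?thesis"
    obtain x r where [simp]: "s = (x, r)" by (cases s)
    have x: "x \<in> V" using s by (simp add: bad_def)
    have "finite {y \<in> V. dist_G z y < r - edge_length x z}" if "{x, z} \<in> E" for z
      using none that edgeD(2)[OF that] by (auto simp: bad_def)
    \<comment> \<open>A point of the ball other than the centre lies in the reduced ball of some
      neighbour, and there are finitely many neighbours.\<close>
    moreover have "{y \<in> V. dist_G x y < r}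
        \<subseteq> insert x (\<Union>z\<in>{z. {x, z} \<in> E}. {y \<in> V. dist_G z y < r - edge_length x z})"
    proof
      fix y assume "y \<in> {y \<in> V. dist_G x y < r}"
      then show "y \<in> insert x (\<Union>z\<in>{z. {x, z} \<in> E}. {y \<in> V. dist_G z y < r - edge_length x z})"
        using dist_first_step[OF x, of y r] by (cases "y = x") auto
    qed
    ultimately have "finite {y \<in> V. dist_G x y < r}"
      using finite_neighbours[of x] by (auto intro: finite_subset)
    then show False using s by (simp add: bad_def)
  qed
  have "\<exists>f. \<forall>n. bad (f n) \<and> {fst (f n), fst (f (Suc n))} \<in> E \<and>
      snd (f (Suc n)) = snd (f n) - edge_length (fst (f n)) (fst (f (Suc n)))"
    using dependent_nat_choice[of "\<lambda>_. bad" "\<lambda>_ s t. {fst s, fst t} \<in> E \<and> snd t = snd s - edge_length (fst s) (fst t)"]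
      bad0 step by blast
  then obtain f where f: "\<And>n. bad (f n)" "\<And>n. {fst (f n), fst (f (Suc n))} \<in> E"
      "\<And>n. snd (f (Suc n)) = snd (f n) - edge_length (fst (f n)) (fst (f (Suc n)))" by blast
  define y where "y n = fst (f n)" for n
  define \<rho> where "\<rho> n = snd (f n)" for n
  have yV: "y n \<in> V" for n using f(1)[of n] by (auto simp: bad_def y_def)
  \<comment> \<open>A ball of negative radius is empty, hence not infinite. So the initial radius
    bounds the total length of the path.\<close>
  have \<rho>_pos: "0 \<le> \<rho> n" for n
  proof (rule ccontr)
    assume "\<not> ?thesis"
    then have "{z \<in> V. dist_G (y n) z < \<rho> n} = {}" 
      by (smt (verit) Collect_empty_eq G.nonneg)
    moreover have "infinite {z \<in> V. dist_G (y n) z < \<rho> n}"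
      using f(1)[of n] by (simp add: bad_def y_def \<rho>_def case_prod_beta)
    ultimately show False by (metis finite.emptyI)
  qed
  have \<rho>_Suc: "\<rho> (Suc n) = \<rho> n - edge_length (y n) (y (Suc n))" for n
    using f(3) by (simp add: y_def \<rho>_def)
  have E: "{y n, y (Suc n)} \<in> E" for n using f(2) by (simp add: y_def)
  have dec: "decseq \<rho>"
    by (rule decseq_SucI) (use \<rho>_Suc edge_length_pos[OF E] in \<open>simp add: less_imp_le\<close>)
  have dist_le: "dist_G (y n) (y (n + k)) \<le> \<rho> n - \<rho> (n + k)" for n k
  proof (induction k)
    case 0
    then show ?case using yV by simp
  next
    case (Suc k)
    have "dist_G (y n) (y (n + Suc k)) \<le> dist_G (y n) (y (n + k)) + dist_G (y (n + k)) (y (n + Suc k))"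
      using G.triangle yV by simp
    with Suc dist_le_edge_length[OF E, of "n + k"] \<rho>_Suc[of "n + k"] show ?case by simp
  qed
  obtain L where L: "\<rho> \<longlonglongrightarrow> L" "\<And>n. L \<le> \<rho> n"
    using decseq_convergent[OF dec] \<rho>_pos by blast
  have cau: "G.MCauchy y"
    unfolding G.MCauchy_def
  proof (intro conjI allI impI)
    show "range y \<subseteq> V" using yV by auto
    fix e :: real assume "0 < e"
    then have "\<forall>\<^sub>F n in sequentially. \<rho> n < L + e" using L(1) by (intro order_tendstoD) auto
    then obtain M where M: "\<And>n. n \<ge> M \<Longrightarrow> \<rho> n < L + e" by (auto simp: eventually_sequentially)
    have "dist_G (y n) (y k) < e" if "M \<le> n" "n \<le> k" for n k
      using dist_le[of n "k - n"] that M[of n] L(2)[of k] by simp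
    then have "dist_G (y n) (y k) < e" if "M \<le> n" "M \<le> k" for n k
      using that G.commute by (cases n k rule: le_cases) metis+
    then show "\<exists>M. \<forall>n n'. M \<le> n \<longrightarrow> M \<le> n' \<longrightarrow> dist_G (y n) (y n') < e" by blast
  qed
  then obtain z where z: "limitin G.mtopology y z sequentially"
    using complete G.mcomplete_def by blast
  then have zV: "z \<in> V" by (simp add: G.limitin_metric)
  obtain \<delta> where \<delta>: "0 < \<delta>" "\<And>x. x \<in> V \<Longrightarrow> x \<noteq> z \<Longrightarrow> \<delta> \<le> dist_G z x"
    using vertex_isolated[OF zV] by blast
  obtain M where M: "\<And>n. n \<ge> M \<Longrightarrow> dist_G (y n) z < \<delta>"
    using z \<delta>(1) unfolding G.limit_metric_sequentially by blast
  have "y n = z" if "n \<ge> M" for n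
    using \<delta>(2)[OF yV[of n]] M[OF that] G.commute[of z "y n"] by fastforce
  then have "y M = y (Suc M)" by simp
  with edgeD(3)[OF E[of M]] show False by simp
qed

text \<open>The function 1 + \<open>\<epsilon>\<close> (\<open>R\<close> - distance to a base
  point), truncated to [0,1]: it is 1 on a closed ball containing \<open>F\<close> and vanishes from
  distance \<open>R\<close> + 1/\<open>\<epsilon>\<close> on. A small slope enlarges the support,
  which stays finite by \<open>finite_balls\<close>. Along an edge the distance varies by at most
  the edge length.\<close>

lemma cutoff:
  fixes F :: "'v set" and \<epsilon> :: real
  assumes F: "finite F" "F \<subseteq> V" and \<epsilon>: "0 < \<epsilon>"
  obtains \<phi> :: "'v \<Rightarrow> real" where
    "\<And>x. 0 \<le> \<phi> x" "\<And>x. \<phi> x \<le> 1" "\<And>x. x \<in> F \<Longrightarrow> \<phi> x = 1"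
    "finite {x. \<phi> x \<noteq> 0}" "{x. \<phi> x \<noteq> 0} \<subseteq> V"
    "\<And>x y. {x, y} \<in> E \<Longrightarrow> \<bar>\<phi> x - \<phi> y\<bar> \<le> \<epsilon> * edge_length x y"
proof (cases "V = {}")
  case True
  with F show ?thesis
    by (intro that[of "\<lambda>_. 0"]) (use \<epsilon> edgeD in auto)
next
  case False
  then obtain c where c: "c \<in> V" by blast
  \<comment> \<open>Inserting 0 covers an empty \<open>F\<close>.\<close>
  define R where "R = Max (insert 0 (dist_G c ` F))"
  define \<phi> where "\<phi> x = (if x \<in> V then max 0 (min 1 (1 + \<epsilon> * (R - dist_G c x))) else 0)" for x
  have R: "dist_G c x \<le> R" if "x \<in> F" for x
    unfolding R_def using F that by (intro Max_ge) auto
  have supp: "{x. \<phi> x \<noteq> 0} \<subseteq> {x \<in> V. dist_G c x < R + 1 / \<epsilon>}"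
  proof
    fix x assume "x \<in> {x. \<phi> x \<noteq> 0}"
    then have "x \<in> V" "0 < 1 + \<epsilon> * (R - dist_G c x)"
      by (auto simp: \<phi>_def max_def min_def split: if_splits)
    with \<epsilon> show "x \<in> {x \<in> V. dist_G c x < R + 1 / \<epsilon>}" by (simp add: field_simps)
  qed
  show ?thesis
  proof (rule that[of \<phi>])
    show "finite {x. \<phi> x \<noteq> 0}" using supp finite_balls[OF c] by (rule finite_subset)
    show "{x. \<phi> x \<noteq> 0} \<subseteq> V" using supp by auto
    show "\<phi> x = 1" if "x \<in> F" for x
      using that F(2) mult_nonneg_nonneg[of \<epsilon> "R - dist_G c x"] R[OF that] \<epsilon> by (auto simp: \<phi>_def)
    fix x y assume e: "{x, y} \<in> E"
    note V = edgeD[OF e]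
    have "\<bar>dist_G c x - dist_G c y\<bar> \<le> edge_length x y"
      using G.triangle[OF c V(1) V(2)] G.triangle[OF c V(2) V(1)] G.commute[of x y] dist_le_edge_length[OF e]
      by linarith
    then have "\<epsilon> * \<bar>dist_G c x - dist_G c y\<bar> \<le> \<epsilon> * edge_length x y" using \<epsilon> by simp
    moreover have "\<bar>\<phi> x - \<phi> y\<bar> \<le> \<bar>\<epsilon> * (R - dist_G c x) - \<epsilon> * (R - dist_G c y)\<bar>"
      using V by (simp add: \<phi>_def)
    moreover have "\<bar>\<epsilon> * (R - dist_G c x) - \<epsilon> * (R - dist_G c y)\<bar> = \<epsilon> * \<bar>dist_G c x - dist_G c y\<bar>"
      using \<epsilon> by (simp add: abs_mult abs_minus_commute flip: right_diff_distrib)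
    ultimately show "\<bar>\<phi> x - \<phi> y\<bar> \<le> \<epsilon> * edge_length x y" by linarith
  qed (auto simp: \<phi>_def)
qed

end

section \<open>Green's formula and the energy estimate\<close>

text \<open>
  \<open>A\<close> stands for \<open>u(x)\<close>, \<open>B\<close> for the transported value of \<open>u(y)\<close>, and \<open>p\<close>, \<open>r\<close> for the values
  of a cutoff at \<open>x\<close> and \<open>y\<close>.
\<close>

lemma weighted_difference_lower_bound:
  fixes A B :: complex and p r :: real
  assumes "0 \<le> p" "0 \<le> r"
  shows "(p\<^sup>2 + r\<^sup>2) / 4 * (cmod (A - B))\<^sup>2 - (p - r)\<^sup>2 * ((cmod A)\<^sup>2 + (cmod B)\<^sup>2)
    \<le> Re ((A - B) * cnj (of_real (p\<^sup>2) * A - of_real (r\<^sup>2) * B))"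
proof -
  define D where "D = A - B"
  define S where "S = A + B"
  \<comment> \<open>In terms of the difference and the sum, \<open>p\<^sup>2 A - r\<^sup>2 B\<close>
    is half of \<open>(p\<^sup>2 + r\<^sup>2) D + (p\<^sup>2 - r\<^sup>2) S\<close>; only the
    \<open>S\<close> part has no sign.\<close>
  have eq: "(A - B) * cnj (of_real (p\<^sup>2) * A - of_real (r\<^sup>2) * B)
      = of_real ((p\<^sup>2 + r\<^sup>2) / 2) * (D * cnj D) + of_real ((p - r) * (p + r) / 2) * (D * cnj S)"
    by (simp add: D_def S_def field_simps power2_eq_square)
  have Re_eq: "Re ((A - B) * cnj (of_real (p\<^sup>2) * A - of_real (r\<^sup>2) * B))
      = (p\<^sup>2 + r\<^sup>2) / 2 * (cmod D)\<^sup>2 + (p - r) * (p + r) / 2 * Re (D * cnj S)"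
    unfolding eq by (simp only: plus_complex.sel Re_complex_of_real complex_norm_square[symmetric] times_complex.sel Im_complex_of_real of_real_power[symmetric])
  have "\<bar>Re (D * cnj S)\<bar> \<le> cmod D * cmod S"
    using abs_Re_le_cmod[of "D * cnj S"] by (simp add: norm_mult)
  then have "\<bar>(p - r) * (p + r) / 2 * Re (D * cnj S)\<bar> \<le> \<bar>p - r\<bar> * (p + r) / 2 * (cmod D * cmod S)"
    using assms by (simp add: abs_mult mult_left_mono)
  also have "\<dots> = ((p + r) / 2 * cmod D) * (\<bar>p - r\<bar> * cmod S)" by simp
  also have "\<dots> \<le> (((p + r) / 2 * cmod D)\<^sup>2 + (\<bar>p - r\<bar> * cmod S)\<^sup>2) / 2"
    using sum_squares_bound[of "(p + r) / 2 * cmod D" "\<bar>p - r\<bar> * cmod S"] by simp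
  also have "\<dots> = (p + r)\<^sup>2 / 8 * (cmod D)\<^sup>2 + (p - r)\<^sup>2 / 2 * (cmod S)\<^sup>2"
    by (simp add: power_mult_distrib power_divide)
  \<comment> \<open>Half of the main term pays for the \<open>D\<close> part of the mixed term; this
    is why 1/4 rather than 1/2 survives in the bound.\<close>
  also have "\<dots> \<le> (p\<^sup>2 + r\<^sup>2) / 4 * (cmod D)\<^sup>2 + (p - r)\<^sup>2 * ((cmod A)\<^sup>2 + (cmod B)\<^sup>2)"
  proof (rule add_mono)
    have "(p + r)\<^sup>2 / 8 \<le> (p\<^sup>2 + r\<^sup>2) / 4"
      using sum_squares_bound[of p r] by (simp add: power2_sum)
    then show "(p + r)\<^sup>2 / 8 * (cmod D)\<^sup>2 \<le> (p\<^sup>2 + r\<^sup>2) / 4 * (cmod D)\<^sup>2" by (rule mult_right_mono) simp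
    have "(cmod S)\<^sup>2 / 2 \<le> (cmod A)\<^sup>2 + (cmod B)\<^sup>2"
      using cmod_add_sq_le[of A B] by (simp add: S_def)
    from mult_left_mono[OF this, of "(p - r)\<^sup>2"]
    show "(p - r)\<^sup>2 / 2 * (cmod S)\<^sup>2 \<le> (p - r)\<^sup>2 * ((cmod A)\<^sup>2 + (cmod B)\<^sup>2)" by simp
  qed
  finally have "- ((p - r) * (p + r) / 2 * Re (D * cnj S))
      \<le> (p\<^sup>2 + r\<^sup>2) / 4 * (cmod D)\<^sup>2 + (p - r)\<^sup>2 * ((cmod A)\<^sup>2 + (cmod B)\<^sup>2)" by linarith
  moreover have "(p\<^sup>2 + r\<^sup>2) / 2 * (cmod D)\<^sup>2 = (p\<^sup>2 + r\<^sup>2) / 4 * (cmod D)\<^sup>2 + (p\<^sup>2 + r\<^sup>2) / 4 * (cmod D)\<^sup>2"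
    by simp
  ultimately show ?thesis unfolding Re_eq unfolding D_def by linarith
qed

text \<open>The condition on \<open>q\<close> is taken over all oriented edges and with nonnegative
  \<open>C\<close>, so that it applies at either orientation of an edge and \<open>C\<close> can be
  used as a factor in monotone estimates.\<close>

locale magnetic_graph = complete_weighted_graph w V E a q N
  for w :: "'v \<Rightarrow> real" and V E a q N +
  fixes \<sigma> :: "'v \<times> 'v \<Rightarrow> complex" and W :: "'v \<Rightarrow> real" and C :: real
  assumes a_swap: "e \<in> oriented_edges E \<Longrightarrow> a (prod.swap e) = a e"
    and \<sigma>_norm: "e \<in> oriented_edges E \<Longrightarrow> cmod (\<sigma> e) = 1"
    and \<sigma>_swap: "e \<in> oriented_edges E \<Longrightarrow> \<sigma> (prod.swap e) = cnj (\<sigma> e)"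
    and W_ge: "x \<in> V \<Longrightarrow> - q x \<le> W x"
    and q_variation: "e \<in> oriented_edges E \<Longrightarrow>
      \<bar>1 / sqrt (q (snd e)) - 1 / sqrt (q (fst e))\<bar> \<le> C * sqrt (min (w (snd e)) (w (fst e)) / a e)"
    and C_nonneg: "0 \<le> C"
begin

abbreviation Lap where "Lap \<equiv> magnetic_laplacian E w a \<sigma>"
abbreviation H where "H \<equiv> magnetic_schroedinger E w a \<sigma> W"

text \<open>Parallel transport: the phase brings the value of \<open>u\<close> at the terminus into
  the gauge of the origin. \<open>mdiff\<close> is thus a covariant difference.\<close>

definition transported :: "('v \<Rightarrow> complex) \<Rightarrow> 'v \<times> 'v \<Rightarrow> complex" where
  "transported u e = \<sigma> (prod.swap e) * u (snd e)"

definition mdiff :: "('v \<Rightarrow> complex) \<Rightarrow> 'v \<times> 'v \<Rightarrow> complex" where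
  "mdiff u e = u (fst e) - transported u e"

lemma \<sigma>_mult_swap: "e \<in> oriented_edges E \<Longrightarrow> \<sigma> e * \<sigma> (prod.swap e) = 1"
  using \<sigma>_norm[of e] \<sigma>_swap[of e] complex_norm_square[of "\<sigma> e"] by simp

lemma norm_transported: "e \<in> oriented_edges E \<Longrightarrow> cmod (transported u e) = cmod (u (snd e))"
  using \<sigma>_norm[of "prod.swap e"] by (simp add: transported_def norm_mult oriented_edges_swap)

text \<open>Reversal multiplies by a unimodular factor independent of \<open>u\<close>, so a product
  of one difference with the conjugate of another does not depend on orientation.\<close>

lemma mdiff_swap:
  assumes "e \<in> oriented_edges E"
  shows "mdiff u (prod.swap e) = - \<sigma> e * mdiff u e"
proof -
  have "- \<sigma> e * mdiff u e = (\<sigma> e * \<sigma> (prod.swap e)) * u (snd e) - \<sigma> e * u (fst e)"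
    by (simp add: mdiff_def transported_def algebra_simps)
  then show ?thesis by (simp add: \<sigma>_mult_swap[OF assms] mdiff_def transported_def)
qed

lemma mdiff_add: "mdiff (\<lambda>x. u x + v x) e = mdiff u e + mdiff v e"
  and mdiff_scale: "mdiff (\<lambda>x. c * u x) e = c * mdiff u e"
  by (simp_all add: mdiff_def transported_def algebra_simps)

lemma Lap_eq: "Lap u x = 1 / complex_of_real (w x) * (\<Sum>e\<in>edges_from x. complex_of_real (a e) * mdiff u e)"
  unfolding magnetic_laplacian_def edges_from_def mdiff_def transported_def
  by (intro arg_cong2[where f="(*)"] refl sum.cong) auto

lemma Lap_weighted:
  assumes "x \<in> V"
  shows "complex_of_real (w x) * Lap u x = (\<Sum>e\<in>edges_from x. complex_of_real (a e) * mdiff u e)"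
  using w_pos[OF assms] by (simp add: Lap_eq)

lemma H_add: "H (\<lambda>x. u x + v x) = (\<lambda>x. H u x + H v x)"
  by (rule ext) (simp add: magnetic_schroedinger_def Lap_eq mdiff_add sum.distrib algebra_simps)

lemma H_scale: "H (\<lambda>x. c * u x) = (\<lambda>x. c * H u x)"
  by (rule ext) (simp add: magnetic_schroedinger_def Lap_eq mdiff_scale sum_distrib_left algebra_simps)

lemma H_zero: "H (\<lambda>x. 0) = (\<lambda>x. 0)"
  using H_scale[of 0 "\<lambda>x. 0"] by simp

lemma H_off:
  assumes "u x = 0" "x \<notin> V"
  shows "H u x = 0"
  by (simp add: magnetic_schroedinger_def Lap_eq edges_from_off assms)

text \<open>One end in \<open>F\<close> is enough: the set is finite and closed under reversal, and
  it contains every edge on which the difference of a function supported in \<open>F\<close> can be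
  nonzero.\<close>

definition edges_meeting :: "'v set \<Rightarrow> ('v \<times> 'v) set" where
  "edges_meeting F = {e \<in> oriented_edges E. fst e \<in> F \<or> snd e \<in> F}"

lemma edges_meeting_eq: "edges_meeting F = (\<Union>x\<in>F. edges_from x) \<union> prod.swap ` (\<Union>x\<in>F. edges_from x)"
proof (intro equalityI subsetI)
  fix e assume e: "e \<in> edges_meeting F"
  then have "prod.swap e \<in> oriented_edges E" by (simp add: edges_meeting_def oriented_edges_swap)
  with e show "e \<in> (\<Union>x\<in>F. edges_from x) \<union> prod.swap ` (\<Union>x\<in>F. edges_from x)"
    by (auto simp: edges_meeting_def edges_from_def intro!: image_eqI[of e prod.swap "prod.swap e"])
qed (auto simp: edges_meeting_def edges_from_def oriented_edges_def insert_commute)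

lemma edges_meeting_finite: "finite F \<Longrightarrow> finite (edges_meeting F)"
  by (simp add: edges_meeting_eq edges_from_finite)

lemma edges_meeting_swap: "prod.swap ` edges_meeting F = edges_meeting F"
proof -
  have sub: "prod.swap ` edges_meeting F \<subseteq> edges_meeting F"
    by (auto simp: edges_meeting_def oriented_edges_def insert_commute)
  from image_mono[OF this, of prod.swap] have "edges_meeting F \<subseteq> prod.swap ` edges_meeting F"
    by (simp add: image_image)
  with sub show ?thesis by auto
qed

lemma sum_edges_swap: "(\<Sum>e\<in>edges_meeting F. c (prod.swap e)) = (\<Sum>e\<in>edges_meeting F. c e)"
proof -
  have "inj_on prod.swap (edges_meeting F)" by (rule inj_onI) (metis swap_swap)
  from sum.reindex[OF this, of c] show ?thesis by (simp add: edges_meeting_swap)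
qed

lemma sum_edges_from:
  fixes c :: "'v \<times> 'v \<Rightarrow> 'b::comm_monoid_add"
  assumes "finite F" and "\<And>e. fst e \<notin> F \<Longrightarrow> c e = 0"
  shows "(\<Sum>x\<in>F. \<Sum>e\<in>edges_from x. c e) = (\<Sum>e\<in>edges_meeting F. c e)"
proof -
  have "(\<Sum>x\<in>F. \<Sum>e\<in>edges_from x. c e) = sum c (\<Union>x\<in>F. edges_from x)"
    by (rule sum.UNION_disjoint[symmetric])
      (use assms edges_from_finite in \<open>auto simp: edges_from_def\<close>)
  also have "\<dots> = sum c (edges_meeting F)"
    by (rule sum.mono_neutral_left[OF edges_meeting_finite[OF assms(1)]])
      (use assms(2) in \<open>auto simp: edges_meeting_def edges_from_def\<close>)
  finally show ?thesis .
qed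

text \<open>Both orientations of an edge occur on the right, hence the factor 1/2. Finite support is
  demanded of \<open>k\<close> alone, since the formula is applied to functions \<open>u\<close> of
  the maximal domain.\<close>

lemma Green:
  assumes F: "finite F" "F \<subseteq> V" and k: "\<And>x. x \<notin> F \<Longrightarrow> k x = 0"
  shows "(\<Sum>x\<in>F. complex_of_real (w x) * Lap u x * cnj (k x))
    = (\<Sum>e\<in>edges_meeting F. complex_of_real (a e) * (mdiff u e * cnj (mdiff k e))) / 2"
proof -
  define c where "c e = complex_of_real (a e) * mdiff u e * cnj (k (fst e))" for e
  have "(\<Sum>x\<in>F. complex_of_real (w x) * Lap u x * cnj (k x)) = (\<Sum>x\<in>F. \<Sum>e\<in>edges_from x. c e)"
  proof (rule sum.cong[OF refl])
    fix x assume "x \<in> F"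
    then show "complex_of_real (w x) * Lap u x * cnj (k x) = (\<Sum>e\<in>edges_from x. c e)"
      using F(2) by (subst Lap_weighted) (auto simp: c_def sum_distrib_right edges_from_def intro!: sum.cong)
  qed
  also have "\<dots> = (\<Sum>e\<in>edges_meeting F. c e)"
    by (rule sum_edges_from[OF F(1)]) (simp add: c_def k)
  \<comment> \<open>Averaging with the reversed sum makes \<open>k\<close> at both ends of an edge
    appear, which assembles \<open>mdiff k\<close>.\<close>
  also have "\<dots> = ((\<Sum>e\<in>edges_meeting F. c e) + (\<Sum>e\<in>edges_meeting F. c (prod.swap e))) / 2"
    by (simp add: sum_edges_swap)
  also have "(\<Sum>e\<in>edges_meeting F. c e) + (\<Sum>e\<in>edges_meeting F. c (prod.swap e))
      = (\<Sum>e\<in>edges_meeting F. complex_of_real (a e) * (mdiff u e * cnj (mdiff k e)))"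
    unfolding sum.distrib[symmetric]
  proof (rule sum.cong[OF refl])
    fix e assume "e \<in> edges_meeting F"
    then have e: "e \<in> oriented_edges E" by (simp add: edges_meeting_def)
    show "c e + c (prod.swap e) = complex_of_real (a e) * (mdiff u e * cnj (mdiff k e))"
      by (simp add: c_def a_swap[OF e] mdiff_swap[OF e] mdiff_def[of k] transported_def \<sigma>_swap[OF e] algebra_simps)
  qed
  finally show ?thesis .
qed

text \<open>Here the degree bound enters quantitatively: a vertex is the origin of at most
  \<open>N\<close> edges, so its mass is counted at most \<open>N\<close> times.\<close>

lemma sum_fst_le:
  assumes A: "finite A" "A \<subseteq> oriented_edges E" and u: "u \<in> l2 w V"
  shows "(\<Sum>e\<in>A. w (fst e) * (cmod (u (fst e)))\<^sup>2) \<le> real N * l2_sq w V u"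
proof -
  let ?g = "\<lambda>x. w x * (cmod (u x))\<^sup>2"
  have V: "fst ` A \<subseteq> V" using A(2) edgeD by (fastforce simp: oriented_edges_def)
  have "(\<Sum>e\<in>A. ?g (fst e)) = (\<Sum>x\<in>fst ` A. \<Sum>e\<in>{e \<in> A. fst e = x}. ?g (fst e))"
    by (rule sum.image_gen[OF A(1)])
  also have "\<dots> \<le> (\<Sum>x\<in>fst ` A. real N * ?g x)"
  proof (rule sum_mono)
    fix x assume x: "x \<in> fst ` A"
    have "card {e \<in> A. fst e = x} \<le> card (edges_from x)"
      using A(2) by (intro card_mono edges_from_finite) (auto simp: edges_from_def)
    also have "\<dots> \<le> N" by (rule card_edges_from)
    finally have "real (card {e \<in> A. fst e = x}) * ?g x \<le> real N * ?g x"
      using V x by (intro mult_right_mono weighted_sq_nonneg) auto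
    then show "(\<Sum>e\<in>{e \<in> A. fst e = x}. ?g (fst e)) \<le> real N * ?g x" by simp
  qed
  also have "\<dots> \<le> real N * l2_sq w V u"
    unfolding sum_distrib_left[symmetric] l2_sq_def using A(1) V weighted_sq_nonneg
    by (intro mult_left_mono finite_sum_le_infsum l2_summable u) auto
  finally show ?thesis .
qed

lemma sum_snd_le:
  assumes A: "finite A" "A \<subseteq> oriented_edges E" and u: "u \<in> l2 w V"
  shows "(\<Sum>e\<in>A. w (snd e) * (cmod (u (snd e)))\<^sup>2) \<le> real N * l2_sq w V u"
proof -
  have "inj_on prod.swap A" by (rule inj_onI) (metis swap_swap)
  from sum.reindex[OF this, of "\<lambda>e. w (fst e) * (cmod (u (fst e)))\<^sup>2"]
  have "(\<Sum>e\<in>A. w (snd e) * (cmod (u (snd e)))\<^sup>2) = (\<Sum>e\<in>prod.swap ` A. w (fst e) * (cmod (u (fst e)))\<^sup>2)"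
    by simp
  also have "\<dots> \<le> real N * l2_sq w V u"
    using A u by (intro sum_fst_le) (auto simp: oriented_edges_def insert_commute)
  finally show ?thesis .
qed

text \<open>The square of this function is the energy weight; multiplied by \<open>q\<close> it
  gives 1, which cancels the growth allowed to the negative part of \<open>W\<close>.\<close>

definition \<rho> :: "'v \<Rightarrow> real" where "\<rho> x = 1 / sqrt (q x)"

lemma \<rho>_bounds: "x \<in> V \<Longrightarrow> 0 < \<rho> x" "x \<in> V \<Longrightarrow> \<rho> x \<le> 1" "x \<in> V \<Longrightarrow> (\<rho> x)\<^sup>2 * q x = 1"
  using q_ge_1[of x] by (auto simp: \<rho>_def power_divide)

text \<open>The minimum permits the weight of either end, so the error of a cutoff, multiplied by
  \<open>a\<close>, becomes a multiple of vertex mass at whichever end the function is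
  evaluated.\<close>

lemma a_edge_length_sq:
  assumes e: "{x, y} \<in> E" and d: "\<bar>d\<bar> \<le> c * (min (sqrt (w x)) (sqrt (w y)) / sqrt (a (x, y)))"
  shows "a (x, y) * d\<^sup>2 \<le> c\<^sup>2 * w x" "a (x, y) * d\<^sup>2 \<le> c\<^sup>2 * w y"
proof -
  have a: "0 < a (x, y)" and w: "0 < w x" "0 < w y"
    using e a_pos[of "(x, y)"] edgeD[OF e] w_pos by (auto simp: oriented_edges_iff)
  have "d\<^sup>2 \<le> (c * (min (sqrt (w x)) (sqrt (w y)) / sqrt (a (x, y))))\<^sup>2"
    using d by (metis abs_ge_zero power2_abs power_mono)
  also have "\<dots> = c\<^sup>2 * (min (sqrt (w x)) (sqrt (w y)))\<^sup>2 / a (x, y)"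
    using a by (simp add: power_mult_distrib power_divide)
  also have "(min (sqrt (w x)) (sqrt (w y)))\<^sup>2 = min (w x) (w y)"
    using w by (simp add: min_def)
  finally have *: "a (x, y) * d\<^sup>2 \<le> c\<^sup>2 * min (w x) (w y)" using a by (simp add: field_simps)
  have "c\<^sup>2 * min (w x) (w y) \<le> c\<^sup>2 * w x" "c\<^sup>2 * min (w x) (w y) \<le> c\<^sup>2 * w y"
    by (auto intro!: mult_left_mono)
  with * show "a (x, y) * d\<^sup>2 \<le> c\<^sup>2 * w x" "a (x, y) * d\<^sup>2 \<le> c\<^sup>2 * w y" by linarith+
qed

text \<open>A product rule. The cutoff contributes 1 because \<open>\<rho>\<close> is at most 1; the
  variation of \<open>\<rho>\<close> contributes \<open>C\<close>, which is where the hypothesis on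
  \<open>q\<close> is used.\<close>

lemma cutoff_\<rho>_variation:
  assumes e: "{x, y} \<in> E" and \<phi>: "\<And>x. 0 \<le> \<phi> x" "\<And>x. \<phi> x \<le> 1"
    and lip: "\<bar>\<phi> x - \<phi> y\<bar> \<le> edge_length x y"
  shows "\<bar>\<phi> x * \<rho> x - \<phi> y * \<rho> y\<bar> \<le> (1 + C) * (min (sqrt (w x)) (sqrt (w y)) / sqrt (a (x, y)))"
proof -
  let ?l = "min (sqrt (w x)) (sqrt (w y)) / sqrt (a (x, y))"
  have V: "x \<in> V" "y \<in> V" using edgeD[OF e] by auto
  have a: "0 < a (x, y)" and w: "0 < w x" "0 < w y"
    using e a_pos[of "(x, y)"] V w_pos by (auto simp: oriented_edges_iff)
  have l: "0 \<le> ?l" using a w by simp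
  have "edge_length x y = ?l * min (\<rho> x) (\<rho> y)" by (simp add: edge_length_def \<rho>_def)
  also have "\<dots> \<le> ?l * 1" using \<rho>_bounds(2)[OF V(1)] l by (intro mult_left_mono) auto
  finally have 1: "\<bar>\<phi> x - \<phi> y\<bar> \<le> ?l" using lip by simp
  have "sqrt (min (w y) (w x) / a (x, y)) = ?l"
    by (simp add: real_sqrt_divide min_def)
  with q_variation[of "(x, y)"] e have 2: "\<bar>\<rho> y - \<rho> x\<bar> \<le> C * ?l"
    by (simp add: oriented_edges_iff \<rho>_def)
  have "\<phi> x * \<rho> x - \<phi> y * \<rho> y = (\<phi> x - \<phi> y) * \<rho> x + \<phi> y * (\<rho> x - \<rho> y)" by (simp add: algebra_simps)
  also have "\<bar>\<dots>\<bar> \<le> \<bar>\<phi> x - \<phi> y\<bar> * \<rho> x + \<phi> y * \<bar>\<rho> y - \<rho> x\<bar>"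
    using \<rho>_bounds(1)[OF V(1)] \<phi>(1)[of y] abs_triangle_ineq[of "(\<phi> x - \<phi> y) * \<rho> x" "\<phi> y * (\<rho> x - \<rho> y)"]
    by (simp add: abs_mult abs_minus_commute)
  also have "\<dots> \<le> ?l * 1 + 1 * (C * ?l)"
    using 1 2 \<rho>_bounds[OF V(1)] \<phi>[of y] l C_nonneg by (intro add_mono mult_mono) auto
  finally show ?thesis by (simp add: algebra_simps add_divide_distrib)
qed

text \<open>The lower bound on \<open>W\<close> is used here, pointwise. One copy of |u|^2 comes
  from splitting the product of |Hu| and |u|, the other from the potential, whose negative part
  becomes at most 1 after weighting.\<close>

lemma Re_H_pairing_le:
  assumes x: "x \<in> V" and p: "0 \<le> p" "p \<le> 1"
  shows "w x * (p * \<rho> x)\<^sup>2 * Re (Lap u x * cnj (u x)) \<le> w x * (cmod (H u x))\<^sup>2 + 2 * (w x * (cmod (u x))\<^sup>2)"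
proof -
  have p2: "p\<^sup>2 \<le> 1" using p by (simp add: power_le_one)
  have r2: "(\<rho> x)\<^sup>2 \<le> 1" using \<rho>_bounds[OF x] by (simp add: power_le_one)
  have t: "(p * \<rho> x)\<^sup>2 \<le> 1" using mult_mono[OF p2 r2] by (simp add: power_mult_distrib)
  have "Lap u x * cnj (u x) = H u x * cnj (u x) - of_real (W x) * of_real ((cmod (u x))\<^sup>2)"
    unfolding complex_norm_square by (simp add: magnetic_schroedinger_def algebra_simps)
  then have eq: "Re (Lap u x * cnj (u x)) = Re (H u x * cnj (u x)) - W x * (cmod (u x))\<^sup>2" by simp
  have "Re (H u x * cnj (u x)) \<le> cmod (H u x) * cmod (u x)"
    using complex_Re_le_cmod[of "H u x * cnj (u x)"] by (simp add: norm_mult)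
  also have "\<dots> \<le> (cmod (H u x))\<^sup>2 + (cmod (u x))\<^sup>2"
    using sum_squares_bound[of "cmod (H u x)" "cmod (u x)"] mult_nonneg_nonneg[OF norm_ge_zero[of "H u x"] norm_ge_zero[of "u x"]]
    by linarith
  finally have "(p * \<rho> x)\<^sup>2 * Re (H u x * cnj (u x)) \<le> (p * \<rho> x)\<^sup>2 * ((cmod (H u x))\<^sup>2 + (cmod (u x))\<^sup>2)"
    by (rule mult_left_mono) simp
  also have "\<dots> \<le> 1 * ((cmod (H u x))\<^sup>2 + (cmod (u x))\<^sup>2)"
    using t by (rule mult_right_mono) simp
  finally have h: "(p * \<rho> x)\<^sup>2 * Re (H u x * cnj (u x)) \<le> (cmod (H u x))\<^sup>2 + (cmod (u x))\<^sup>2" by simp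
  have "(p * \<rho> x)\<^sup>2 * - W x \<le> (p * \<rho> x)\<^sup>2 * q x"
    using W_ge[OF x] by (intro mult_left_mono) auto
  also have "\<dots> = p\<^sup>2 * ((\<rho> x)\<^sup>2 * q x)" by (simp add: power_mult_distrib)
  also have "\<dots> \<le> 1" using p2 \<rho>_bounds(3)[OF x] by simp
  finally have "(p * \<rho> x)\<^sup>2 * - W x * (cmod (u x))\<^sup>2 \<le> 1 * (cmod (u x))\<^sup>2" by (rule mult_right_mono) simp
  with h have "(p * \<rho> x)\<^sup>2 * Re (Lap u x * cnj (u x)) \<le> (cmod (H u x))\<^sup>2 + 2 * (cmod (u x))\<^sup>2"
    unfolding eq by (simp add: algebra_simps)
  from mult_left_mono[OF this, of "w x"] w_pos[OF x] show ?thesis by (simp add: algebra_simps)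
qed

text \<open>A Caccioppoli-type inequality: the energy is bounded by the norms of \<open>u\<close>
  and \<open>H u\<close>, uniformly over finite edge sets, so summability of the full energy need
  not be discussed.\<close>

lemma energy_bounded:
  assumes u: "u \<in> l2 w V" and Hu: "H u \<in> l2 w V"
  obtains K where
    "\<And>A. finite A \<Longrightarrow> A \<subseteq> oriented_edges E \<Longrightarrow> (\<Sum>e\<in>A. a e * (\<rho> (fst e))\<^sup>2 * (cmod (mdiff u e))\<^sup>2) \<le> K"
proof -
  \<comment> \<open>The 4 undoes the 1/4 in the edgewise lower bound, a further 2 comes from the
    half in Green's formula (giving 8), and the last term counts both ends of each edge. Nothing
    depends on \<open>A\<close>.\<close>
  define K where "K = 8 * (l2_sq w V (H u) + 2 * l2_sq w V u) + 4 * (2 * (1 + C)\<^sup>2 * (real N * l2_sq w V u))"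
  have "(\<Sum>e\<in>A. a e * (\<rho> (fst e))\<^sup>2 * (cmod (mdiff u e))\<^sup>2) \<le> K"
    if A: "finite A" "A \<subseteq> oriented_edges E" for A
  proof -
    define F0 where "F0 = fst ` A"
    have F0: "finite F0" "F0 \<subseteq> V"
      using A edgeD by (fastforce simp: F0_def oriented_edges_def)+
    obtain \<phi> where \<phi>: "\<And>x. 0 \<le> \<phi> x" "\<And>x. \<phi> x \<le> 1" "\<And>x. x \<in> F0 \<Longrightarrow> \<phi> x = (1::real)"
      "finite {x. \<phi> x \<noteq> 0}" "{x. \<phi> x \<noteq> 0} \<subseteq> V"
      "\<And>x y. {x, y} \<in> E \<Longrightarrow> \<bar>\<phi> x - \<phi> y\<bar> \<le> 1 * edge_length x y"
      by (rule cutoff[OF F0 zero_less_one]) (rule that)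
    define F where "F = {x. \<phi> x \<noteq> 0}"
    define \<psi> where "\<psi> x = \<phi> x * \<rho> x" for x
    define k where "k x = of_real ((\<psi> x)\<^sup>2) * u x" for x
    let ?EF = "edges_meeting F"
    let ?n = "\<lambda>e. (cmod (u (fst e)))\<^sup>2 + (cmod (u (snd e)))\<^sup>2"
    have F: "finite F" "F \<subseteq> V" using \<phi>(4,5) by (auto simp: F_def)
    have EF: "finite ?EF" "?EF \<subseteq> oriented_edges E"
      using edges_meeting_finite[OF F(1)] by (auto simp: edges_meeting_def)
    have k0: "k x = 0" if "x \<notin> F" for x using that by (simp add: k_def \<psi>_def F_def)
    have "(\<Sum>x\<in>F. w x * (\<psi> x)\<^sup>2 * Re (Lap u x * cnj (u x)))
        \<le> (\<Sum>x\<in>F. w x * (cmod (H u x))\<^sup>2 + 2 * (w x * (cmod (u x))\<^sup>2))"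
      unfolding \<psi>_def using F(2) \<phi>(1,2) by (intro sum_mono Re_H_pairing_le) auto
    also have "\<dots> = (\<Sum>x\<in>F. w x * (cmod (H u x))\<^sup>2) + 2 * (\<Sum>x\<in>F. w x * (cmod (u x))\<^sup>2)"
      by (simp add: sum.distrib sum_distrib_left)
    also have "\<dots> \<le> l2_sq w V (H u) + 2 * l2_sq w V u"
      unfolding l2_sq_def using F weighted_sq_nonneg
      by (intro add_mono mult_left_mono finite_sum_le_infsum l2_summable u Hu) auto
    finally have upper: "(\<Sum>x\<in>F. w x * (\<psi> x)\<^sup>2 * Re (Lap u x * cnj (u x))) \<le> l2_sq w V (H u) + 2 * l2_sq w V u" .
    have "(\<Sum>x\<in>F. w x * (\<psi> x)\<^sup>2 * Re (Lap u x * cnj (u x)))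
        = Re (\<Sum>x\<in>F. complex_of_real (w x) * Lap u x * cnj (k x))"
      unfolding Re_sum
    proof (rule sum.cong[OF refl])
      fix x
      have "complex_of_real (w x) * Lap u x * cnj (k x) = of_real (w x * (\<psi> x)\<^sup>2) * (Lap u x * cnj (u x))"
        by (simp add: k_def)
      then show "w x * (\<psi> x)\<^sup>2 * Re (Lap u x * cnj (u x)) = Re (complex_of_real (w x) * Lap u x * cnj (k x))"
        by (simp only: Re_complex_of_real times_complex.sel Im_complex_of_real)
    qed
    also have "\<dots> = Re (\<Sum>e\<in>?EF. complex_of_real (a e) * (mdiff u e * cnj (mdiff k e))) / 2"
      by (simp add: Green[where u=u, OF F k0])
    also have "Re (\<Sum>e\<in>?EF. complex_of_real (a e) * (mdiff u e * cnj (mdiff k e)))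
        = (\<Sum>e\<in>?EF. a e * Re (mdiff u e * cnj (mdiff k e)))" by simp
    finally have green: "(\<Sum>e\<in>?EF. a e * Re (mdiff u e * cnj (mdiff k e)))
        = 2 * (\<Sum>x\<in>F. w x * (\<psi> x)\<^sup>2 * Re (Lap u x * cnj (u x)))" by simp
    have lower: "(a e * (\<psi> (fst e))\<^sup>2 * (cmod (mdiff u e))\<^sup>2) / 4
        \<le> a e * Re (mdiff u e * cnj (mdiff k e)) + (1 + C)\<^sup>2 * (w (fst e) * (cmod (u (fst e)))\<^sup>2)
           + (1 + C)\<^sup>2 * (w (snd e) * (cmod (u (snd e)))\<^sup>2)" if "e \<in> ?EF" for e
    proof -
      have e: "e \<in> oriented_edges E" using that EF by auto
      obtain x y where xy: "e = (x, y)" by (cases e)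
      have xyE: "{x, y} \<in> E" using e xy by (simp add: oriented_edges_iff)
      have V: "x \<in> V" "y \<in> V" using edgeD[OF xyE] by auto
      define B where "B = transported u e"
      have B: "cmod B = cmod (u y)" using norm_transported[OF e, of u] by (simp add: B_def xy)
      have D: "mdiff u e = u x - B" by (simp add: mdiff_def B_def xy)
      have Dk: "mdiff k e = of_real ((\<psi> x)\<^sup>2) * u x - of_real ((\<psi> y)\<^sup>2) * B"
        by (simp add: mdiff_def B_def k_def transported_def xy)
      have a: "0 < a e" by (rule a_pos[OF e])
      have \<psi>0: "0 \<le> \<psi> x" "0 \<le> \<psi> y" using \<phi>(1) \<rho>_bounds(1) V by (auto simp: \<psi>_def less_imp_le)
      have "\<bar>\<psi> x - \<psi> y\<bar> \<le> (1 + C) * (min (sqrt (w x)) (sqrt (w y)) / sqrt (a (x, y)))"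
        unfolding \<psi>_def using \<phi>(6)[OF xyE] by (intro cutoff_\<rho>_variation xyE \<phi>) simp
      note var = a_edge_length_sq[OF xyE this]
      \<comment> \<open>The contribution of the terminus is dropped: the energy is weighted at the
        origin only.\<close>
      have "(\<psi> x)\<^sup>2 / 4 * (cmod (u x - B))\<^sup>2 \<le> ((\<psi> x)\<^sup>2 + (\<psi> y)\<^sup>2) / 4 * (cmod (u x - B))\<^sup>2"
        by (rule mult_right_mono) auto
      also have "\<dots> \<le> Re (mdiff u e * cnj (mdiff k e)) + (\<psi> x - \<psi> y)\<^sup>2 * ((cmod (u x))\<^sup>2 + (cmod (u y))\<^sup>2)"
        using weighted_difference_lower_bound[OF \<psi>0, of "u x" B] unfolding D Dk B by simp
      finally have "a e * ((\<psi> x)\<^sup>2 / 4 * (cmod (u x - B))\<^sup>2)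
          \<le> a e * (Re (mdiff u e * cnj (mdiff k e)) + (\<psi> x - \<psi> y)\<^sup>2 * ((cmod (u x))\<^sup>2 + (cmod (u y))\<^sup>2))"
        using a by (intro mult_left_mono) auto
      also have "\<dots> = a e * Re (mdiff u e * cnj (mdiff k e)) + (a e * (\<psi> x - \<psi> y)\<^sup>2) * (cmod (u x))\<^sup>2
          + (a e * (\<psi> x - \<psi> y)\<^sup>2) * (cmod (u y))\<^sup>2" by (simp add: algebra_simps)
      also have "\<dots> \<le> a e * Re (mdiff u e * cnj (mdiff k e)) + ((1 + C)\<^sup>2 * w x) * (cmod (u x))\<^sup>2
          + ((1 + C)\<^sup>2 * w y) * (cmod (u y))\<^sup>2"
        using var by (intro add_mono mult_right_mono order_refl) (auto simp: xy)
      finally show ?thesis unfolding D[symmetric] by (simp add: xy algebra_simps)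
    qed
    \<comment> \<open>The cutoff is 1 at all origins of \<open>A\<close>, so \<open>\<psi>\<close>
      and \<open>\<rho>\<close> agree there.\<close>
    have "(\<Sum>e\<in>A. a e * (\<rho> (fst e))\<^sup>2 * (cmod (mdiff u e))\<^sup>2)
        = (\<Sum>e\<in>A. a e * (\<psi> (fst e))\<^sup>2 * (cmod (mdiff u e))\<^sup>2)"
      using \<phi>(3) by (intro sum.cong) (auto simp: \<psi>_def F0_def)
    also have "\<dots> \<le> (\<Sum>e\<in>?EF. a e * (\<psi> (fst e))\<^sup>2 * (cmod (mdiff u e))\<^sup>2)"
    proof (rule sum_mono2[OF EF(1)])
      show "A \<subseteq> ?EF"
      proof
        fix e assume "e \<in> A"
        then show "e \<in> ?EF" using A(2) \<phi>(3)[of "fst e"] by (auto simp: F0_def F_def edges_meeting_def)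
      qed
      show "0 \<le> a e * (\<psi> (fst e))\<^sup>2 * (cmod (mdiff u e))\<^sup>2" if "e \<in> ?EF - A" for e
        using that EF(2) a_pos[of e] by auto
    qed
    also have "\<dots> \<le> (\<Sum>e\<in>?EF. 4 * (a e * Re (mdiff u e * cnj (mdiff k e)) + (1 + C)\<^sup>2 * (w (fst e) * (cmod (u (fst e)))\<^sup>2)
           + (1 + C)\<^sup>2 * (w (snd e) * (cmod (u (snd e)))\<^sup>2)))"
      using lower by (intro sum_mono) (simp add: divide_le_eq mult.commute)
    also have "\<dots> = 4 * ((\<Sum>e\<in>?EF. a e * Re (mdiff u e * cnj (mdiff k e)))
        + (1 + C)\<^sup>2 * (\<Sum>e\<in>?EF. w (fst e) * (cmod (u (fst e)))\<^sup>2)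
        + (1 + C)\<^sup>2 * (\<Sum>e\<in>?EF. w (snd e) * (cmod (u (snd e)))\<^sup>2))"
      by (simp only: sum_distrib_left[symmetric] sum.distrib)
    also have "\<dots> \<le> 4 * (2 * (l2_sq w V (H u) + 2 * l2_sq w V u)
        + (1 + C)\<^sup>2 * (real N * l2_sq w V u) + (1 + C)\<^sup>2 * (real N * l2_sq w V u))"
      unfolding green using upper
      by (intro mult_left_mono add_mono sum_fst_le sum_snd_le EF u) auto
    also have "\<dots> = K" by (simp add: K_def algebra_simps)
    finally show ?thesis .
  qed
  then show ?thesis by (rule that)
qed

end

section \<open>Symmetry of the maximal operator\<close>

context magnetic_graph
begin

text \<open>The two minima in the edge length can be resolved at different ends:
  \<open>\<rho>\<close> at the origin, to match the energy of the difference \<open>s\<close>, and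
  \<open>w\<close> at the terminus, to match the mass of the value \<open>t\<close>.\<close>

lemma edge_pairing_bound:
  assumes e: "{x, y} \<in> E" and d: "\<bar>d\<bar> \<le> \<epsilon> * edge_length x y" and \<epsilon>: "0 < \<epsilon>" and s: "0 \<le> s" "0 \<le> t"
  shows "a (x, y) * (\<bar>d\<bar> * (s * t)) \<le> \<epsilon> / 2 * (a (x, y) * (\<rho> x)\<^sup>2 * s\<^sup>2 + w y * t\<^sup>2)"
proof -
  have V: "x \<in> V" "y \<in> V" using edgeD[OF e] by auto
  have a: "0 < a (x, y)" and w: "0 < w x" "0 < w y"
    using e a_pos[of "(x, y)"] V w_pos by (auto simp: oriented_edges_iff)
  have "a (x, y) * edge_length x y = sqrt (a (x, y)) * (min (sqrt (w x)) (sqrt (w y)) * min (\<rho> x) (\<rho> y))"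
    using a real_div_sqrt[of "a (x, y)"] by (simp add: edge_length_def \<rho>_def divide_inverse mult_ac)
  also have "\<dots> \<le> sqrt (a (x, y)) * (sqrt (w y) * \<rho> x)"
    using a w \<rho>_bounds(1) V by (intro mult_left_mono mult_mono) (auto simp: min_def less_imp_le)
  finally have ael: "a (x, y) * edge_length x y \<le> sqrt (a (x, y)) * (sqrt (w y) * \<rho> x)" .
  have "a (x, y) * (\<bar>d\<bar> * (s * t)) \<le> a (x, y) * ((\<epsilon> * edge_length x y) * (s * t))"
    using a d s by (intro mult_left_mono mult_right_mono) auto
  also have "\<dots> = (\<epsilon> * (s * t)) * (a (x, y) * edge_length x y)" by simp
  also have "\<dots> \<le> (\<epsilon> * (s * t)) * (sqrt (a (x, y)) * (sqrt (w y) * \<rho> x))"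
    using ael \<epsilon> s by (intro mult_left_mono) auto
  also have "\<dots> = \<epsilon> / 2 * (2 * (sqrt (a (x, y)) * \<rho> x * s) * (sqrt (w y) * t))" by simp
  also have "\<dots> \<le> \<epsilon> / 2 * ((sqrt (a (x, y)) * \<rho> x * s)\<^sup>2 + (sqrt (w y) * t)\<^sup>2)"
    using \<epsilon> by (intro mult_left_mono sum_squares_bound) auto
  also have "\<dots> = \<epsilon> / 2 * (a (x, y) * (\<rho> x)\<^sup>2 * s\<^sup>2 + w y * t\<^sup>2)"
    using a w by (simp add: power_mult_distrib)
  finally show ?thesis .
qed

text \<open>The real potential cancels pointwise, and by the Leibniz rule for \<open>mdiff\<close>
  so do the terms in which the cutoff is not differenced. Only its variation along edges
  remains.\<close>

lemma cutoff_commutator: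
  assumes F: "finite F" "F \<subseteq> V" and \<phi>: "\<And>x. x \<notin> F \<Longrightarrow> \<phi> x = (0::real)"
  shows "(\<Sum>x\<in>F. of_real (\<phi> x) * (of_real (w x) * H u x * cnj (v x) - of_real (w x) * u x * cnj (H v x)))
    = (\<Sum>e\<in>edges_meeting F. of_real (a e) * (of_real (\<phi> (fst e) - \<phi> (snd e)) *
        (mdiff u e * cnj (transported v e) - cnj (mdiff v e) * transported u e))) / 2"
proof -
  define \<phi>v where "\<phi>v x = of_real (\<phi> x) * v x" for x
  define \<phi>u where "\<phi>u x = of_real (\<phi> x) * u x" for x
  have 0: "\<phi>v x = 0" "\<phi>u x = 0" if "x \<notin> F" for x using \<phi>[OF that] by (simp_all add: \<phi>v_def \<phi>u_def)
  have D: "mdiff \<phi>v e = of_real (\<phi> (fst e)) * mdiff v e + of_real (\<phi> (fst e) - \<phi> (snd e)) * transported v e"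
    "mdiff \<phi>u e = of_real (\<phi> (fst e)) * mdiff u e + of_real (\<phi> (fst e) - \<phi> (snd e)) * transported u e" for e
    by (simp_all add: \<phi>v_def \<phi>u_def mdiff_def transported_def algebra_simps)
  have pt: "mdiff u e * cnj (mdiff \<phi>v e) - cnj (mdiff v e) * mdiff \<phi>u e
      = of_real (\<phi> (fst e) - \<phi> (snd e)) * (mdiff u e * cnj (transported v e) - cnj (mdiff v e) * transported u e)" for e
    by (simp add: D algebra_simps)
  have "(\<Sum>x\<in>F. of_real (\<phi> x) * (of_real (w x) * H u x * cnj (v x) - of_real (w x) * u x * cnj (H v x)))
      = (\<Sum>x\<in>F. complex_of_real (w x) * Lap u x * cnj (\<phi>v x)) - cnj (\<Sum>x\<in>F. complex_of_real (w x) * Lap v x * cnj (\<phi>u x))"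
    unfolding cnj_sum sum_subtractf[symmetric]
    by (intro sum.cong refl) (simp add: magnetic_schroedinger_def \<phi>v_def \<phi>u_def algebra_simps)
  also have "\<dots> = (\<Sum>e\<in>edges_meeting F. of_real (a e) * (mdiff u e * cnj (mdiff \<phi>v e)
      - cnj (mdiff v e) * mdiff \<phi>u e)) / 2"
    by (simp add: Green[where u=u, OF F 0(1)] Green[where u=v, OF F 0(2)] right_diff_distrib
        sum_subtractf diff_divide_distrib)
  finally show ?thesis by (simp only: pt)
qed

text \<open>The right-hand side is linear in \<open>\<epsilon>\<close> and does not see
  \<open>F\<close> or \<open>\<phi>\<close> otherwise. The 1/4 combines the half of Green's formula
  with the half in \<open>edge_pairing_bound\<close>.\<close>

lemma cutoff_commutator_bound:
  assumes u: "u \<in> l2 w V" and v: "v \<in> l2 w V"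
    and Ku: "\<And>A. finite A \<Longrightarrow> A \<subseteq> oriented_edges E \<Longrightarrow> (\<Sum>e\<in>A. a e * (\<rho> (fst e))\<^sup>2 * (cmod (mdiff u e))\<^sup>2) \<le> Ku"
    and Kv: "\<And>A. finite A \<Longrightarrow> A \<subseteq> oriented_edges E \<Longrightarrow> (\<Sum>e\<in>A. a e * (\<rho> (fst e))\<^sup>2 * (cmod (mdiff v e))\<^sup>2) \<le> Kv"
    and F: "finite F" "F \<subseteq> V" and \<phi>: "\<And>x. x \<notin> F \<Longrightarrow> \<phi> x = (0::real)"
    and \<epsilon>: "0 < \<epsilon>" and lip: "\<And>x y. {x, y} \<in> E \<Longrightarrow> \<bar>\<phi> x - \<phi> y\<bar> \<le> \<epsilon> * edge_length x y"
  shows "cmod (\<Sum>x\<in>F. of_real (\<phi> x) * (of_real (w x) * H u x * cnj (v x) - of_real (w x) * u x * cnj (H v x)))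
    \<le> \<epsilon> / 4 * (Ku + Kv + real N * l2_sq w V u + real N * l2_sq w V v)"
proof -
  let ?EF = "edges_meeting F"
  have EF: "finite ?EF" "?EF \<subseteq> oriented_edges E"
    using edges_meeting_finite[OF F(1)] by (auto simp: edges_meeting_def)
  let ?t = "\<lambda>e. of_real (a e) * (of_real (\<phi> (fst e) - \<phi> (snd e)) *
        (mdiff u e * cnj (transported v e) - cnj (mdiff v e) * transported u e))"
  have "cmod (\<Sum>e\<in>?EF. ?t e) \<le> (\<Sum>e\<in>?EF. cmod (?t e))" by (rule norm_sum)
  also have "\<dots> \<le> (\<Sum>e\<in>?EF. \<epsilon> / 2 * (a e * (\<rho> (fst e))\<^sup>2 * (cmod (mdiff u e))\<^sup>2 + w (snd e) * (cmod (v (snd e)))\<^sup>2)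
      + \<epsilon> / 2 * (a e * (\<rho> (fst e))\<^sup>2 * (cmod (mdiff v e))\<^sup>2 + w (snd e) * (cmod (u (snd e)))\<^sup>2))"
  proof (rule sum_mono)
    fix e assume "e \<in> ?EF"
    then have e: "e \<in> oriented_edges E" using EF by auto
    obtain x y where xy: "e = (x, y)" by (cases e)
    have xyE: "{x, y} \<in> E" using e xy by (simp add: oriented_edges_iff)
    have a: "0 < a e" by (rule a_pos[OF e])
    have "cmod (mdiff u e * cnj (transported v e) - cnj (mdiff v e) * transported u e)
        \<le> cmod (mdiff u e) * cmod (v y) + cmod (mdiff v e) * cmod (u y)"
      using norm_triangle_ineq4[of "mdiff u e * cnj (transported v e)" "cnj (mdiff v e) * transported u e"]
        norm_transported[OF e, of u] norm_transported[OF e, of v] by (simp add: norm_mult xy)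
    then have "cmod (?t e) \<le> a e * (\<bar>\<phi> x - \<phi> y\<bar> * (cmod (mdiff u e) * cmod (v y) + cmod (mdiff v e) * cmod (u y)))"
      using a by (auto simp: norm_mult xy simp flip: of_real_diff intro!: mult_left_mono)
    also have "\<dots> = a (x, y) * (\<bar>\<phi> x - \<phi> y\<bar> * (cmod (mdiff u e) * cmod (v y)))
        + a (x, y) * (\<bar>\<phi> x - \<phi> y\<bar> * (cmod (mdiff v e) * cmod (u y)))"
      by (simp add: xy distrib_left)
    also have "\<dots> \<le> \<epsilon> / 2 * (a (x, y) * (\<rho> x)\<^sup>2 * (cmod (mdiff u e))\<^sup>2 + w y * (cmod (v y))\<^sup>2)
      + \<epsilon> / 2 * (a (x, y) * (\<rho> x)\<^sup>2 * (cmod (mdiff v e))\<^sup>2 + w y * (cmod (u y))\<^sup>2)"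
      by (intro add_mono edge_pairing_bound xyE lip \<epsilon>) auto
    finally show "cmod (?t e) \<le> \<epsilon> / 2 * (a e * (\<rho> (fst e))\<^sup>2 * (cmod (mdiff u e))\<^sup>2 + w (snd e) * (cmod (v (snd e)))\<^sup>2)
      + \<epsilon> / 2 * (a e * (\<rho> (fst e))\<^sup>2 * (cmod (mdiff v e))\<^sup>2 + w (snd e) * (cmod (u (snd e)))\<^sup>2)"
      by (simp add: xy)
  qed
  also have "\<dots> = \<epsilon> / 2 * ((\<Sum>e\<in>?EF. a e * (\<rho> (fst e))\<^sup>2 * (cmod (mdiff u e))\<^sup>2) + (\<Sum>e\<in>?EF. w (snd e) * (cmod (v (snd e)))\<^sup>2))
      + \<epsilon> / 2 * ((\<Sum>e\<in>?EF. a e * (\<rho> (fst e))\<^sup>2 * (cmod (mdiff v e))\<^sup>2) + (\<Sum>e\<in>?EF. w (snd e) * (cmod (u (snd e)))\<^sup>2))"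
    by (simp only: sum_distrib_left[symmetric] sum.distrib)
  also have "\<dots> \<le> \<epsilon> / 2 * (Ku + real N * l2_sq w V v) + \<epsilon> / 2 * (Kv + real N * l2_sq w V u)"
    using \<epsilon> by (intro add_mono mult_left_mono Ku Kv sum_snd_le EF u v) auto
  also have "\<dots> = 2 * (\<epsilon> / 4 * (Ku + Kv + real N * l2_sq w V u + real N * l2_sq w V v))"
    by (simp add: algebra_simps)
  finally have "cmod (\<Sum>e\<in>?EF. ?t e) / 2
      \<le> \<epsilon> / 4 * (Ku + Kv + real N * l2_sq w V u + real N * l2_sq w V v)" by simp
  moreover have "(\<Sum>x\<in>F. of_real (\<phi> x) * (of_real (w x) * H u x * cnj (v x) - of_real (w x) * u x * cnj (H v x)))
      = (\<Sum>e\<in>?EF. ?t e) / 2"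
    by (rule cutoff_commutator) (fact F \<phi>)+
  ultimately show ?thesis by (simp only: norm_divide norm_numeral)
qed

text \<open>The difference of the pairings is the sum of an absolutely summable \<open>h\<close>.
  Its cutoff part is a commutator of order \<open>\<epsilon>\<close>; the rest is supported where
  the cutoff differs from 1 and is dominated by a tail of \<open>h\<close>.\<close>

lemma H_symmetric:
  assumes u: "u \<in> l2 w V" "H u \<in> l2 w V" and v: "v \<in> l2 w V" "H v \<in> l2 w V"
  shows "l2_inner w V (H u) v = l2_inner w V u (H v)"
proof -
  define h where "h x = of_real (w x) * H u x * cnj (v x) - of_real (w x) * u x * cnj (H v x)" for x
  have norm_h: "(\<lambda>x. cmod (h x)) summable_on V"
  proof (rule summable_on_comparison_test)
    show "(\<lambda>x. cmod (of_real (w x) * H u x * cnj (v x)) + cmod (of_real (w x) * u x * cnj (H v x))) summable_on V"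
      by (intro summable_on_add l2_inner_summable u v)
  qed (simp_all add: h_def norm_triangle_ineq4)
  have h: "h summable_on V" by (rule abs_summable_summable[OF norm_h])
  have eq: "l2_inner w V (H u) v - l2_inner w V u (H v) = infsum h V"
    unfolding l2_inner_def h_def
    by (rule infsum_minus[symmetric]) (intro l2_inner_summable' u v)+
  obtain Ku where Ku: "\<And>A. finite A \<Longrightarrow> A \<subseteq> oriented_edges E \<Longrightarrow> (\<Sum>e\<in>A. a e * (\<rho> (fst e))\<^sup>2 * (cmod (mdiff u e))\<^sup>2) \<le> Ku"
    by (rule energy_bounded[OF u]) (rule that)
  obtain Kv where Kv: "\<And>A. finite A \<Longrightarrow> A \<subseteq> oriented_edges E \<Longrightarrow> (\<Sum>e\<in>A. a e * (\<rho> (fst e))\<^sup>2 * (cmod (mdiff v e))\<^sup>2) \<le> Kv"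
    by (rule energy_bounded[OF v]) (rule that)
  \<comment> \<open>The added 1 accounts for the tail and makes division by \<open>K\<close>
    possible.\<close>
  define K where "K = (Ku + Kv + real N * l2_sq w V u + real N * l2_sq w V v) / 4 + 1"
  have "0 \<le> Ku" "0 \<le> Kv" using Ku[of "{}"] Kv[of "{}"] by auto
  then have K: "0 < K" using l2_sq_nonneg[of u] l2_sq_nonneg[of v]
    by (simp add: K_def add_nonneg_pos)
  have bound: "cmod (infsum h V) \<le> \<epsilon> * K" if \<epsilon>: "0 < \<epsilon>" for \<epsilon>
  proof -
    obtain F0 where F0: "finite F0" "F0 \<subseteq> V" "dist (\<Sum>x\<in>F0. cmod (h x)) (infsum (\<lambda>x. cmod (h x)) V) \<le> \<epsilon>"
      using infsum_finite_approximation[OF norm_h \<epsilon>] by blast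
    obtain \<phi> where \<phi>: "\<And>x. 0 \<le> \<phi> x" "\<And>x. \<phi> x \<le> 1" "\<And>x. x \<in> F0 \<Longrightarrow> \<phi> x = (1::real)"
      "finite {x. \<phi> x \<noteq> 0}" "{x. \<phi> x \<noteq> 0} \<subseteq> V"
      "\<And>x y. {x, y} \<in> E \<Longrightarrow> \<bar>\<phi> x - \<phi> y\<bar> \<le> \<epsilon> * edge_length x y"
      by (rule cutoff[OF F0(1,2) \<epsilon>]) (rule that)
    define F where "F = {x. \<phi> x \<noteq> 0}"
    define r where "r x = of_real (1 - \<phi> x) * h x" for x
    have F: "finite F" "F \<subseteq> V" "\<And>x. x \<notin> F \<Longrightarrow> \<phi> x = 0" using \<phi>(4,5) by (auto simp: F_def)
    have "infsum (\<lambda>x. of_real (\<phi> x) * h x) V = infsum (\<lambda>x. of_real (\<phi> x) * h x) F"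
      by (rule infsum_cong_neutral) (use F in auto)
    then have near_eq: "infsum (\<lambda>x. of_real (\<phi> x) * h x) V = (\<Sum>x\<in>F. of_real (\<phi> x) * h x)"
      using F(1) by simp
    have r_le: "cmod (r x) \<le> cmod (h x)" for x
      using \<phi>(1)[of x] \<phi>(2)[of x] unfolding r_def norm_mult norm_of_real
      by (intro mult_left_le_one_le) auto
    have norm_r: "(\<lambda>x. cmod (r x)) summable_on V"
      by (rule summable_on_comparison_test[OF norm_h r_le]) auto
    have "infsum (\<lambda>x. of_real (\<phi> x) * h x) V = infsum (\<lambda>x. h x - r x) V"
      by (simp add: r_def algebra_simps)
    also have "\<dots> = infsum h V - infsum r V"
      by (rule infsum_minus[OF h abs_summable_summable[OF norm_r]])
    finally have split: "infsum h V = (\<Sum>x\<in>F. of_real (\<phi> x) * h x) + infsum r V"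
      using near_eq by simp
    \<comment> \<open>The remainder vanishes on \<open>F0\<close>, which was chosen to carry all but
      \<open>\<epsilon>\<close> of the absolute sum.\<close>
    have "cmod (infsum r V) \<le> infsum (\<lambda>x. cmod (r x)) V"
      by (rule norm_infsum_bound[OF norm_r])
    also have "\<dots> = infsum (\<lambda>x. cmod (r x)) (V - F0)"
      using \<phi>(3) by (intro infsum_cong_neutral) (auto simp: r_def)
    also have "\<dots> \<le> infsum (\<lambda>x. cmod (h x)) (V - F0)"
      using summable_on_subset_banach[OF norm_r, of "V - F0"] summable_on_subset_banach[OF norm_h, of "V - F0"] r_le
      by (intro infsum_mono) auto
    also have "\<dots> = infsum (\<lambda>x. cmod (h x)) V - (\<Sum>x\<in>F0. cmod (h x))"
      using infsum_Diff[OF norm_h _ F0(2)] F0(1) by simp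
    also have "\<dots> \<le> \<epsilon>" using abs_le_D2[OF F0(3)[unfolded dist_real_def]] by simp
    finally have far: "cmod (infsum r V) \<le> \<epsilon>" .
    have "cmod (\<Sum>x\<in>F. of_real (\<phi> x) * h x) \<le> \<epsilon> / 4 * (Ku + Kv + real N * l2_sq w V u + real N * l2_sq w V v)"
      unfolding h_def by (rule cutoff_commutator_bound) (fact u(1) v(1) Ku Kv F \<epsilon> \<phi>(6))+
    with far show ?thesis
      unfolding split using norm_triangle_ineq[of "\<Sum>x\<in>F. of_real (\<phi> x) * h x" "infsum r V"]
      by (simp add: K_def distrib_left add_divide_distrib)
  qed
  have "cmod (infsum h V) \<le> 0"
  proof (rule field_le_epsilon)
    fix e :: real assume "0 < e"
    then show "cmod (infsum h V) \<le> 0 + e" using bound[of "e / K"] K by simp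
  qed
  with eq show ?thesis by simp
qed

section \<open>Essential self-adjointness\<close>

abbreviation max_domain where "max_domain \<equiv> {u \<in> l2 w V. H u \<in> l2 w V}"
abbreviation H_min where "H_min \<equiv> restricted_operator H (finitely_supported V)"
abbreviation H_max where "H_max \<equiv> restricted_operator H max_domain"

lemma H_local:
  assumes "u x = v x" and "\<And>y. {x, y} \<in> E \<Longrightarrow> u y = v y"
  shows "H u x = H v x"
proof -
  have "mdiff u e = mdiff v e" if "e \<in> edges_from x" for e
    using that assms by (cases e) (auto simp: edges_from_def oriented_edges_iff mdiff_def transported_def)
  then show ?thesis by (simp add: magnetic_schroedinger_def Lap_eq assms(1))
qed

lemma H_finitely_supported:
  assumes u: "u \<in> finitely_supported V"
  shows "H u \<in> finitely_supported V"
proof -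
  define S where "S = {x \<in> V. u x \<noteq> 0}"
  have u0: "u x = 0" if "x \<notin> S" for x
    using that u by (auto simp: S_def finitely_supported_def vertex_functions_def)
  have "finite (S \<union> (\<Union>y\<in>S. {z. {y, z} \<in> E}))"
    using u finite_neighbours by (auto simp: S_def finitely_supported_def)
  moreover have "{x \<in> V. H u x \<noteq> 0} \<subseteq> S \<union> (\<Union>y\<in>S. {z. {y, z} \<in> E})"
  proof (rule subsetI, rule ccontr)
    fix x assume x: "x \<in> {x \<in> V. H u x \<noteq> 0}" "x \<notin> S \<union> (\<Union>y\<in>S. {z. {y, z} \<in> E})"
    then have "H u x = H (\<lambda>x. 0) x" by (intro H_local u0) (auto simp: insert_commute)
    with x(1) show False by (simp add: H_zero)
  qed
  ultimately have "finite {x \<in> V. H u x \<noteq> 0}" by (rule finite_subset[rotated])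
  then show ?thesis using u H_off by (auto simp: finitely_supported_def vertex_functions_def)
qed

lemma finitely_supported_max_domain: "finitely_supported V \<subseteq> max_domain"
  using finitely_supported_l2 H_finitely_supported by blast

lemma finitely_supported_add:
  assumes "u \<in> finitely_supported V" "v \<in> finitely_supported V"
  shows "(\<lambda>x. u x + v x) \<in> finitely_supported V"
proof -
  have "finite {x \<in> V. u x + v x \<noteq> 0}"
    by (rule finite_subset[of _ "{x \<in> V. u x \<noteq> 0} \<union> {x \<in> V. v x \<noteq> 0}"])
      (use assms in \<open>auto simp: finitely_supported_def\<close>)
  then show ?thesis using assms by (auto simp: finitely_supported_def vertex_functions_def)
qed

lemma finitely_supported_scale:
  assumes "u \<in> finitely_supported V"
  shows "(\<lambda>x. c * u x) \<in> finitely_supported V"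
proof -
  have "finite {x \<in> V. c * u x \<noteq> 0}"
    by (rule finite_subset[of _ "{x \<in> V. u x \<noteq> 0}"]) (use assms in \<open>auto simp: finitely_supported_def\<close>)
  then show ?thesis using assms by (auto simp: finitely_supported_def vertex_functions_def)
qed

definition delta :: "'v \<Rightarrow> 'v \<Rightarrow> complex" where
  "delta x y = (if y = x then 1 else 0)"

lemma delta_finitely_supported: "x \<in> V \<Longrightarrow> delta x \<in> finitely_supported V"
  by (auto simp: finitely_supported_def vertex_functions_def delta_def)

lemma inner_delta_left:
  assumes "x \<in> V"
  shows "l2_inner w V (delta x) g = of_real (w x) * cnj (g x)"
proof -
  have "l2_inner w V (delta x) g = infsum (\<lambda>y. of_real (w y) * delta x y * cnj (g y)) {x}"
    unfolding l2_inner_def using assms by (intro infsum_cong_neutral) (auto simp: delta_def)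
  then show ?thesis by (simp add: delta_def)
qed

text \<open>\<open>v\<close> is arbitrary here, so \<open>H_symmetric\<close> is applied to a
  truncation instead. \<open>H (delta x)\<close> lives on \<open>x\<close> and its neighbours, and
  keeping \<open>v\<close> on this set changes neither the pairing nor \<open>H v\<close> at
  \<open>x\<close>.\<close>

lemma inner_H_delta_left:
  assumes x: "x \<in> V"
  shows "l2_inner w V (H (delta x)) v = of_real (w x) * cnj (H v x)"
proof -
  define S where "S = insert x {y. {x, y} \<in> E}"
  define v' where "v' y = (if y \<in> S then v y else 0)" for y
  have S: "finite S" "S \<subseteq> V" using finite_neighbours edgeD x by (auto simp: S_def)
  have "finite {y \<in> V. v' y \<noteq> 0}" by (rule finite_subset[OF _ S(1)]) (auto simp: v'_def)
  with S(2) have v': "v' \<in> finitely_supported V"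
    by (auto simp: finitely_supported_def vertex_functions_def v'_def)
  have "H (delta x) y * cnj (v y) = H (delta x) y * cnj (v' y)" for y
  proof (cases "y \<in> S")
    case False
    then have "H (delta x) y = H (\<lambda>x. 0) y"
      by (intro H_local) (auto simp: S_def delta_def insert_commute)
    then show ?thesis by (simp add: H_zero)
  qed (simp add: v'_def)
  then have "l2_inner w V (H (delta x)) v = l2_inner w V (H (delta x)) v'"
    unfolding l2_inner_def by (simp only: mult.assoc)
  also have "\<dots> = l2_inner w V (delta x) (H v')"
    using finitely_supported_max_domain v' delta_finitely_supported[OF x] by (intro H_symmetric) auto
  also have "\<dots> = of_real (w x) * cnj (H v' x)" by (rule inner_delta_left[OF x])
  also have "H v' x = H v x" by (rule H_local) (auto simp: v'_def S_def)
  finally show ?thesis .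
qed

lemma restricted_operator_l2_operator:
  assumes "P \<subseteq> max_domain" and "(\<lambda>x. 0) \<in> P"
    and "\<And>u v. u \<in> P \<Longrightarrow> v \<in> P \<Longrightarrow> (\<lambda>x. u x + v x) \<in> P"
    and "\<And>c u. u \<in> P \<Longrightarrow> (\<lambda>x. c * u x) \<in> P"
  shows "l2_operator w V (restricted_operator H P)"
proof -
  have graph: "(u, y) \<in> restricted_operator H P \<longleftrightarrow> u \<in> P \<and> y = H u" for u y
    by (auto simp: restricted_operator_def)
  have "restricted_operator H P \<subseteq> l2 w V \<times> l2 w V"
    using assms(1) by (auto simp: restricted_operator_def)
  moreover have "single_valued (restricted_operator H P)" by (simp add: single_valued_def graph)
  moreover have "(\<lambda>x. 0, \<lambda>x. 0) \<in> restricted_operator H P"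
    using assms(2) by (simp add: graph H_zero)
  moreover have "\<forall>(u, y)\<in>restricted_operator H P. \<forall>(v, z)\<in>restricted_operator H P.
      (\<lambda>x. u x + v x, \<lambda>x. y x + z x) \<in> restricted_operator H P"
    by (clarify, simp only: graph H_add assms(3))
  moreover have "\<forall>c. \<forall>(u, y)\<in>restricted_operator H P. (\<lambda>x. c * u x, \<lambda>x. c * y x) \<in> restricted_operator H P"
    by (clarify, simp only: graph H_scale assms(4))
  ultimately show ?thesis by (simp only: l2_operator_def)
qed

section \<open>Minimal operator, maximal operator, adjoint and closure\<close>

lemma l2_operator_min: "l2_operator w V H_min"
proof (rule restricted_operator_l2_operator[OF finitely_supported_max_domain])
  show "(\<lambda>x. 0) \<in> finitely_supported V" by (simp add: finitely_supported_def vertex_functions_def)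
  show "(\<lambda>x. u x + v x) \<in> finitely_supported V"
    if "u \<in> finitely_supported V" "v \<in> finitely_supported V" for u v
    using that by (rule finitely_supported_add)
  show "(\<lambda>x. c * u x) \<in> finitely_supported V" if "u \<in> finitely_supported V" for c u
    using that by (rule finitely_supported_scale)
qed

lemma l2_operator_max: "l2_operator w V H_max"
proof (rule restricted_operator_l2_operator)
  show "(\<lambda>x. 0) \<in> max_domain" by (simp add: H_zero l2_zero)
  show "(\<lambda>x. u x + v x) \<in> max_domain" if "u \<in> max_domain" "v \<in> max_domain" for u v
    using that by (simp add: H_add l2_add)
  show "(\<lambda>x. c * u x) \<in> max_domain" if "u \<in> max_domain" for c u
    using that by (simp add: H_scale l2_scale)
qed simp

lemma symmetric_max: "(u, y) \<in> H_max \<Longrightarrow> (v, z) \<in> H_max \<Longrightarrow> l2_inner w V y v = l2_inner w V u z"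
  using H_symmetric by (auto simp: restricted_operator_def)

lemma min_subset_max: "H_min \<subseteq> H_max"
  using finitely_supported_max_domain by (auto simp: restricted_operator_def)

text \<open>Testing against \<open>delta x\<close> identifies the value of the adjoint at every
  vertex as \<open>H v\<close>.\<close>

lemma adjoint_min_subset: "l2_adjoint w V H_min \<subseteq> H_max"
proof (rule subrelI)
  fix v z assume "(v, z) \<in> l2_adjoint w V H_min"
  then have vz: "v \<in> l2 w V" "z \<in> l2 w V"
    and *: "\<And>u. u \<in> finitely_supported V \<Longrightarrow> l2_inner w V (H u) v = l2_inner w V u z"
    by (auto simp: l2_adjoint_def restricted_operator_def)
  have "z x = H v x" for x
  proof (cases "x \<in> V")
    case True
    then show ?thesis
      using *[OF delta_finitely_supported[OF True]] w_pos[OF True]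
      by (simp add: inner_H_delta_left inner_delta_left)
  next
    case False
    then show ?thesis using H_off l2_off vz by simp
  qed
  then have "z = H v" by blast
  with vz show "(v, z) \<in> H_max" by (auto simp: restricted_operator_def)
qed

text \<open>Norm convergence implies pointwise convergence, and at each vertex \<open>H\<close> is a
  finite sum, hence continuous for pointwise limits.\<close>

lemma closure_min_subset: "l2_closure w V H_min \<subseteq> H_max"
proof (rule subrelI)
  fix v z assume "(v, z) \<in> l2_closure w V H_min"
  then obtain u y where vz: "v \<in> l2 w V" "z \<in> l2 w V" and uy: "\<And>n::nat. (u n, y n) \<in> H_min"
    and lim: "(\<lambda>n. l2_norm w V (\<lambda>x. u n x - v x)) \<longlonglongrightarrow> 0" "(\<lambda>n. l2_norm w V (\<lambda>x. y n x - z x)) \<longlonglongrightarrow> 0"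
    unfolding l2_closure_def by blast
  have y: "y n = H (u n)" and ul: "u n \<in> l2 w V" "H (u n) \<in> l2 w V" for n
    using uy[of n] finitely_supported_max_domain by (auto simp: restricted_operator_def)
  have u_lim: "(\<lambda>n. u n x) \<longlonglongrightarrow> v x" for x
    using tendsto_power[OF lim(1), of 2] l2_sq_nonneg
    by (intro l2_tendsto_pointwise ul vz) (simp add: l2_norm_eq)
  have "(\<lambda>n. H (u n) x) \<longlonglongrightarrow> z x" for x
    using tendsto_power[OF lim(2), of 2] l2_sq_nonneg
    by (intro l2_tendsto_pointwise ul vz) (simp add: l2_norm_eq y)
  moreover have "(\<lambda>n. H (u n) x) \<longlonglongrightarrow> H v x" for x
    unfolding magnetic_schroedinger_def Lap_eq mdiff_def transported_def
    by (intro tendsto_intros u_lim)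
  ultimately have "z = H v" using LIMSEQ_unique by blast
  with vz show "(v, z) \<in> H_max" by (auto simp: restricted_operator_def)
qed

text \<open>The cross term is a multiple of the imaginary part of the pairing of \<open>H u\<close>
  with \<open>u\<close>, which symmetry makes zero.\<close>

lemma sq_H_minus_i:
  assumes "u \<in> max_domain"
  shows "l2_sq w V (\<lambda>x. H u x + (- \<i>) * u x) = l2_sq w V (H u) + l2_sq w V u"
proof -
  have "l2_inner w V (H u) u = cnj (l2_inner w V (H u) u)"
    using H_symmetric[of u u] l2_inner_cnj[of "H u" u] assms by simp
  then have "Im (l2_inner w V (H u) u) = 0" by (metis complex_cnj_cancel_iff Reals_cnj_iff complex_is_Real_iff)
  then show ?thesis using l2_sq_add_scaled[of "H u" u "- \<i>"] assms by simp
qed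

text \<open>
  The range of \<open>H - \<i>\<close> on finitely supported functions is dense, since a function orthogonal to it
  is an \<open>L\<^sup>2\<close> solution of \<open>H s = - \<i> s\<close>; and \<open>\<parallel>(H - \<i>) u\<parallel>\<^sup>2 = \<parallel>H u\<parallel>\<^sup>2 + \<parallel>u\<parallel>\<^sup>2\<close> turns an
  approximation of \<open>(H - \<i>) v\<close> into one of \<open>v\<close> in the graph norm.
\<close>

lemma max_subset_closure_min: "H_max \<subseteq> l2_closure w V H_min"
proof (rule subrelI)
  fix v z assume "(v, z) \<in> H_max"
  then have v: "v \<in> l2 w V" "H v \<in> l2 w V" and z: "z = H v" by (auto simp: restricted_operator_def)
  define R where "R u = (\<lambda>x. H u x + (- \<i>) * u x)" for u
  define M where "M = R ` finitely_supported V"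
  have Rl: "R u \<in> l2 w V" if "u \<in> max_domain" for u
    unfolding R_def using that by (intro l2_add l2_scale) auto
  have R_add: "R (\<lambda>x. u x + u' x) = (\<lambda>x. R u x + R u' x)" for u u'
    by (simp add: R_def H_add algebra_simps)
  have R_scale: "R (\<lambda>x. c * u x) = (\<lambda>x. c * R u x)" for c u
    by (simp add: R_def H_scale algebra_simps)
  have "\<exists>m. (\<forall>n::nat. m n \<in> M) \<and> (\<lambda>n. l2_sq w V (\<lambda>x. R v x - m n x)) \<longlonglongrightarrow> 0"
  proof (rule l2_dense_if_orthogonal_trivial)
    show "M \<subseteq> l2 w V" using Rl finitely_supported_max_domain by (auto simp: M_def)
    show "M \<noteq> {}" by (auto simp: M_def finitely_supported_def vertex_functions_def)
    show "(\<lambda>x. f x + g x) \<in> M" if fg: "f \<in> M" "g \<in> M" for f g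
    proof -
      obtain u u' where "u \<in> finitely_supported V" "u' \<in> finitely_supported V" "f = R u" "g = R u'"
        using fg unfolding M_def by blast
      then show ?thesis
        unfolding M_def by (intro image_eqI[where x="\<lambda>x. u x + u' x"]) (simp_all only: R_add finitely_supported_add)
    qed
    show "(\<lambda>x. c * f x) \<in> M" if f: "f \<in> M" for c f
    proof -
      obtain u where "u \<in> finitely_supported V" "f = R u"
        using f unfolding M_def by blast
      then show ?thesis
        unfolding M_def by (intro image_eqI[OF _ finitely_supported_scale]) (simp_all only: R_scale)
    qed
    show "R v \<in> l2 w V" using v by (intro Rl) auto
    show "s = (\<lambda>x. 0)" if s: "s \<in> l2 w V" and orth: "\<And>f. f \<in> M \<Longrightarrow> l2_inner w V s f = 0" for s
    proof -
      have Hs: "H s x = - \<i> * s x" for x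
      proof (cases "x \<in> V")
        case True
        note d = delta_finitely_supported[OF True]
        have dl: "delta x \<in> l2 w V" "H (delta x) \<in> l2 w V" using d finitely_supported_max_domain by auto
        have "0 = l2_inner w V s (R (delta x))" using orth d by (simp add: M_def)
        also have "\<dots> = l2_inner w V s (H (delta x)) + cnj (- \<i>) * l2_inner w V s (delta x)"
          unfolding R_def l2_inner_scale_right[symmetric]
          by (rule l2_inner_add_right[OF dl(2) l2_scale[OF dl(1)] s])
        also have "l2_inner w V s (H (delta x)) = of_real (w x) * H s x"
          by (subst l2_inner_cnj) (simp add: inner_H_delta_left True)
        also have "l2_inner w V s (delta x) = of_real (w x) * s x"
          by (subst l2_inner_cnj) (simp add: inner_delta_left True)
        finally have "of_real (w x) * (H s x + \<i> * s x) = 0" by (simp add: algebra_simps)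
        then show ?thesis using w_pos[OF True] by (simp add: eq_neg_iff_add_eq_0)
      next
        case False
        then show ?thesis using H_off l2_off[OF s] by simp
      qed
      then have Hs': "H s = (\<lambda>x. - \<i> * s x)" by (rule ext)
      have Hsl: "H s \<in> l2 w V" unfolding Hs' by (rule l2_scale[OF s])
      \<comment> \<open>Symmetry excludes the nonreal eigenvalue \<open>- \<i>\<close>: the square
        norm of \<open>s\<close> would equal its own negative.\<close>
      have "l2_inner w V (H s) s = l2_inner w V s (H s)" by (rule H_symmetric) (rule s Hsl)+
      then have "- \<i> * l2_inner w V s s = \<i> * l2_inner w V s s"
        unfolding Hs' l2_inner_scale_left l2_inner_scale_right by simp
      then have "l2_sq w V s = 0" by (simp add: l2_inner_self)
      then show ?thesis by (rule l2_sq_eq_0[OF s])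
    qed
  qed
  then obtain m where m: "\<And>n::nat. m n \<in> M" and lim: "(\<lambda>n. l2_sq w V (\<lambda>x. R v x - m n x)) \<longlonglongrightarrow> 0"
    by blast
  then have "\<forall>n. \<exists>u. u \<in> finitely_supported V \<and> m n = R u" by (auto simp: M_def)
  then obtain u where u: "\<And>n. u n \<in> finitely_supported V" "\<And>n. m n = R (u n)" by metis
  have ul: "u n \<in> l2 w V" "H (u n) \<in> l2 w V" for n using u(1) finitely_supported_max_domain by auto
  have sq: "l2_sq w V (\<lambda>x. R v x - m n x)
      = l2_sq w V (\<lambda>x. H (u n) x - z x) + l2_sq w V (\<lambda>x. u n x - v x)" for n
  proof -
    define p where "p = (\<lambda>x. v x + (-1) * u n x)"
    have Hp: "H p = (\<lambda>x. H v x + (-1) * H (u n) x)" unfolding p_def H_add H_scale ..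
    have p: "p \<in> max_domain"
      using l2_diff[OF v(1) ul(1)] l2_diff[OF v(2) ul(2)] by (simp add: Hp) (simp add: p_def)
    have "(\<lambda>x. R v x - m n x) = R p"
      by (simp add: u(2) R_def Hp) (simp add: p_def algebra_simps)
    then have "l2_sq w V (\<lambda>x. R v x - m n x) = l2_sq w V (H p) + l2_sq w V p"
      using sq_H_minus_i[OF p] by (simp add: R_def)
    also have "l2_sq w V (H p) = l2_sq w V (\<lambda>x. H (u n) x - z x)"
      by (simp add: Hp z l2_sq_minus_commute[of "H v"])
    also have "l2_sq w V p = l2_sq w V (\<lambda>x. u n x - v x)"
      by (simp add: p_def l2_sq_minus_commute[of v])
    finally show ?thesis .
  qed
  have "(\<lambda>n. l2_sq w V (\<lambda>x. H (u n) x - z x)) \<longlonglongrightarrow> 0"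
    by (rule tendsto_sandwich[OF _ _ tendsto_const lim]) (simp_all add: l2_sq_nonneg sq)
  from tendsto_real_sqrt[OF this] have 1: "(\<lambda>n. l2_norm w V (\<lambda>x. H (u n) x - z x)) \<longlonglongrightarrow> 0"
    by (simp add: l2_norm_eq)
  have "(\<lambda>n. l2_sq w V (\<lambda>x. u n x - v x)) \<longlonglongrightarrow> 0"
    by (rule tendsto_sandwich[OF _ _ tendsto_const lim]) (simp_all add: l2_sq_nonneg sq)
  from tendsto_real_sqrt[OF this] have 2: "(\<lambda>n. l2_norm w V (\<lambda>x. u n x - v x)) \<longlonglongrightarrow> 0"
    by (simp add: l2_norm_eq)
  have "(u n, H (u n)) \<in> H_min" for n using u(1) by (auto simp: restricted_operator_def)
  with 1 2 have "\<exists>u y. (\<forall>n::nat. (u n, y n) \<in> H_min) \<and>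
      (\<lambda>n. l2_norm w V (\<lambda>x. u n x - v x)) \<longlonglongrightarrow> 0 \<and> (\<lambda>n. l2_norm w V (\<lambda>x. y n x - z x)) \<longlonglongrightarrow> 0"
    by (intro exI[of _ u] exI[of _ "\<lambda>n. H (u n)"] conjI allI)
  with v show "(v, z) \<in> l2_closure w V H_min"
    unfolding l2_closure_def z by simp
qed

text \<open>Symmetry and the reversal of inclusions by adjoints close a circle: \<open>H_max\<close>
  lies in its adjoint, this in the adjoint of \<open>H_min\<close>, and this in
  \<open>H_max\<close>, which is also the closure of \<open>H_min\<close>.\<close>

lemma essentially_self_adjoint: "l2_essentially_self_adjoint w V H_min"
proof -
  have closure: "l2_closure w V H_min = H_max"
    using closure_min_subset max_subset_closure_min by auto
  have dom: "finitely_supported V \<subseteq> Domain H_min" by (force simp: restricted_operator_def)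
  have dense: "l2_densely_defined w V T" if "H_min \<subseteq> T" for T
    using finitely_supported_dense dom Domain_mono[OF that] unfolding l2_densely_defined_def by blast
  have "H_max \<subseteq> l2_adjoint w V H_max"
    using symmetric_max by (auto simp: l2_adjoint_def restricted_operator_def)
  moreover have "l2_adjoint w V H_max \<subseteq> l2_adjoint w V H_min"
    using min_subset_max by (auto simp: l2_adjoint_def)
  ultimately have "l2_adjoint w V H_max = H_max" using adjoint_min_subset by blast
  moreover have "l2_symmetric w V H_min"
    unfolding l2_symmetric_def using min_subset_max symmetric_max by blast
  ultimately show ?thesis
    unfolding l2_essentially_self_adjoint_def l2_self_adjoint_def closure
    using l2_operator_min l2_operator_max dense min_subset_max by blast
qed

end

theorem theorem1p4:
  fixes V :: "'v set" and E :: "'v set set" and Es :: "('v \<times> 'v) set"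
    and w q W :: "'v \<Rightarrow> real" and a :: "'v \<times> 'v \<Rightarrow> real" and \<sigma> :: "'v \<times> 'v \<Rightarrow> complex"
  assumes "simple_graph V E" and "infinite V" and "connected_graph V E"
    and "orientation E Es" and "bounded_degree V E"
    and "\<forall>x\<in>V. w x > 0"
    and "\<forall>e\<in>oriented_edges E. a e > 0 \<and> a (prod.swap e) = a e"
    and "\<forall>e\<in>oriented_edges E. cmod (\<sigma> e) = 1 \<and> \<sigma> (prod.swap e) = cnj (\<sigma> e)"
    and "\<forall>x\<in>V. q x \<ge> 1"
    and "\<forall>x\<in>V. W x \<ge> - q x"
    and "\<exists>C::real. \<forall>e\<in>Es. \<bar>1 / sqrt (q (snd e)) - 1 / sqrt (q (fst e))\<bar>
           \<le> C * sqrt (min (w (snd e)) (w (fst e)) / a e)"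
    and "Metric_space V (path_dist V E w a q)"
    and "Metric_space.mcomplete V (path_dist V E w a q)"
  shows "l2_essentially_self_adjoint w V
           (restricted_operator (magnetic_schroedinger E w a \<sigma> W) (finitely_supported V))"
proof -
  obtain N where N: "\<forall>x\<in>V. finite {e \<in> E. x \<in> e} \<and> card {e \<in> E. x \<in> e} \<le> N"
    using assms(5) unfolding bounded_degree_def by blast
  interpret G: locally_finite_graph w V E a q N
    using assms(1,6,7,9) N by unfold_locales auto
  obtain C where C: "\<And>e. e \<in> Es \<Longrightarrow> \<bar>1 / sqrt (q (snd e)) - 1 / sqrt (q (fst e))\<bar>
      \<le> C * sqrt (min (w (snd e)) (w (fst e)) / a e)"
    using assms(11) by blast
  have E_eq: "oriented_edges E = Es \<union> prod.swap ` Es" using assms(4) by (simp add: orientation_def)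
  have C': "\<bar>1 / sqrt (q (snd e)) - 1 / sqrt (q (fst e))\<bar> \<le> \<bar>C\<bar> * sqrt (min (w (snd e)) (w (fst e)) / a e)"
    if e: "e \<in> oriented_edges E" for e
  proof -
    have "0 < a e" "0 < w (fst e)" "0 < w (snd e)"
      using e G.a_pos G.w_pos G.edgeD by (auto simp: oriented_edges_def)
    then have "C * sqrt (min (w (snd e)) (w (fst e)) / a e) \<le> \<bar>C\<bar> * sqrt (min (w (snd e)) (w (fst e)) / a e)"
      by (intro mult_right_mono) auto
    moreover have "\<bar>1 / sqrt (q (snd e)) - 1 / sqrt (q (fst e))\<bar> \<le> C * sqrt (min (w (snd e)) (w (fst e)) / a e)"
    proof (cases "e \<in> Es")
      case False
      \<comment> \<open>The condition is symmetric in the two ends, so it passes to reversed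
        edges.\<close>
      with e E_eq obtain e0 where "e0 \<in> Es" "e = prod.swap e0" by blast
      then have e': "prod.swap e \<in> Es" by simp
      have "a (prod.swap e) = a e" using assms(7) e by blast
      with C[OF e'] show ?thesis by (simp add: abs_minus_commute min.commute)
    qed (rule C)
    ultimately show ?thesis by linarith
  qed
  interpret complete_weighted_graph w V E a q N
    by (intro complete_weighted_graph.intro complete_weighted_graph_axioms.intro
        G.locally_finite_graph_axioms assms(3,12,13))
  interpret magnetic_graph w V E a q N \<sigma> W "\<bar>C\<bar>"
  proof (intro magnetic_graph.intro magnetic_graph_axioms.intro complete_weighted_graph_axioms)
    show "a (prod.swap e) = a e" "cmod (\<sigma> e) = 1" "\<sigma> (prod.swap e) = cnj (\<sigma> e)"
      if "e \<in> oriented_edges E" for e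
      using that assms(7,8) by blast+
    show "- q x \<le> W x" if "x \<in> V" for x using that assms(10) by blast
  qed (simp_all add: C')
  show ?thesis by (rule essentially_self_adjoint)
qed

end
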